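(* Suppose that $\nu(\{\lambda_1,\dots,\lambda_k\})=1$ for some positive numbers $\lambda_1,\dots,\lambda_k$. Consider the polynomial $$p(v)=\prod_{i=1}^k (v-\lambda_i+\mu)\equiv v^k+\sum_{i=0}^{k-1}c_i v^i,\qquad v\in\mathbb R,$$ for suitable real numbers $c_0,\dots,c_{k-1}$. Then $\{\Phi^{(0)},\Phi^{(1)},\dots,\Phi^{(k-1)}\}$ is a $k$-dimensional sufficient Markov statistic (for the quickest detection problem), with $$\Phi^{(k)}=-\sum_{i=0}^{k-1}c_i\,\Phi^{(i)}.$$
   Context: Let $N=\{N_t;t\ge 0\}$ be a homogeneous Poisson process with rate $\mu>0$ on a probability space $(\Omega,\mathcal H,\mathbb P_0)$ which also supports random variables $\theta$ and $\Lambda$, independent of each other and of $N$ under $\mathbb P_0$. $\Lambda$ has distribution $\nu$, with $m^{(k)}=\int_{\mathbb R}(v-\mu)^k\nu(dv)$ well defined and finite for all $k\in\mathbb N_0=\{0,1,2,\dots\}$, and $\mathbb P_0\{\theta=0\}=\pi$, $\mathbb P_0\{\theta>t\}=(1-\pi)e^{-\lambda t}$, $t\ge 0$, for constants $\lambda>0$, $\pi\in[0,1)$. $\mathbb F=\{\mathcal F_t\}$ is the right-continuous enlargement with $\mathbb P_0$-null sets of the natural filtration of $N$, and $\mathcal G_t=\mathcal F_t\vee\sigma\{\theta,\Lambda\}$. With $h(t)=\mu 1_{\{t<\theta\}}+\Lambda 1_{\{t\ge\theta\}}$ and $$Z_t=\exp\Big\{\int_0^t\log\Big(\frac{h(s-)}{\mu}\Big)dN_s-\int_0^t(h(s)-\mu)\,ds\Big\},$$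 the probability measure $\mathbb P$ is defined by $d\mathbb P/d\mathbb P_0|_{\mathcal G_t}=Z_t$, $t\ge0$; under $\mathbb P$ the rate of $N$ changes at time $\theta$ from $\mu$ to $\Lambda$. Define $$\Pi_t=\mathbb P\{\theta\le t\mid\mathcal F_t\},\qquad \Phi^{(k)}_t=\frac{\mathbb E[(\Lambda-\mu)^k1_{\{\theta\le t\}}\mid\mathcal F_t]}{1-\Pi_t},\quad k\in\mathbb N_0,\ t\ge 0,$$ with $\mathbb E$ the expectation under $\mathbb P$ (right-continuous versions are used; the equality of processes is meant almost surely). The quickest detection problem is to minimize over $\mathbb F$-stopping times $\tau$ the Bayes risk $R_\tau(\pi)=\mathbb P\{\tau<\theta\}+c\,\mathbb E(\tau-\theta)^+$, $c>0$ a constant. This risk equals $1-\pi+c(1-\pi)\mathbb E_0\big[\int_0^\tau e^{-\lambda t}(\Phi^{(0)}_t-\lambda/c)\,dt\big]$, $\mathbb E_0$ being the expectation under $\mathbb P_0$. A finite family of $\mathbb F$-adapted processes containing $\Phi^{(0)}$ is called a sufficient Markov statistic if, taken jointly as a vector-valued process, it is a Markov process (under $\mathbb P_0$), so that the detection problem becomes an optimal stopping problem for this Markov process. *)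

theory Defs
  imports "HOL-Probability.Probability"
begin

text \<open>Processes are indexed by \<^typ>\<open>real\<close>; only their values at times \<open>t \<ge> 0\<close> are ever constrained
  or used. Throughout, \<open>M\<close> is the reference space \<open>(\<Omega>, H, P\<^sub>0)\<close>.\<close>

locale poisson_process = prob_space M
  for M :: "'a measure" +
  fixes N :: "real \<Rightarrow> 'a \<Rightarrow> nat" and \<mu> :: real
  assumes rate_pos: "\<mu> > 0"
    and N_measurable: "\<And>t. 0 \<le> t \<Longrightarrow> N t \<in> measurable M (count_space UNIV)"
    and N_zero: "\<And>\<omega>. \<omega> \<in> space M \<Longrightarrow> N 0 \<omega> = 0"
    and N_mono: "\<And>\<omega> s t. \<omega> \<in> space M \<Longrightarrow> 0 \<le> s \<Longrightarrow> s \<le> t \<Longrightarrow> N s \<omega> \<le> N t \<omega>"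
    and N_right_continuous:
      "\<And>\<omega> t. \<omega> \<in> space M \<Longrightarrow> 0 \<le> t \<Longrightarrow> continuous (at_right t) (\<lambda>s. real (N s \<omega>))"
    and N_indep_increments:
      "\<And>(n::nat) (t::nat \<Rightarrow> real). 0 \<le> t 0 \<Longrightarrow> (\<And>i. i < n \<Longrightarrow> t i < t (Suc i)) \<Longrightarrow>
        indep_vars (\<lambda>_. count_space UNIV) (\<lambda>i \<omega>. N (t (Suc i)) \<omega> - N (t i) \<omega>) {..<n}"
    and N_increment_distr:
      "\<And>s t. 0 \<le> s \<Longrightarrow> s < t \<Longrightarrow>
        distr M (count_space UNIV) (\<lambda>\<omega>. N t \<omega> - N s \<omega>) = measure_pmf (poisson_pmf (\<mu> * (t - s)))"

definition natural_generators :: "'a measure \<Rightarrow> (real \<Rightarrow> 'a \<Rightarrow> nat) \<Rightarrow> real set \<Rightarrow> 'a set set" where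
  "natural_generators M N T = {N s -` A \<inter> space M | s A. s \<in> T}"

definition rv_sets :: "'a measure \<Rightarrow> ('a \<Rightarrow> real) \<Rightarrow> 'a set set" where
  "rv_sets M X = sets (vimage_algebra (space M) X borel)"

text \<open>The filtration \<open>F\<close>: right-continuous enlargement of the natural filtration of \<open>N\<close> with
  the null sets of \<open>M\<close>.\<close>

definition obs_filtration :: "'a measure \<Rightarrow> (real \<Rightarrow> 'a \<Rightarrow> nat) \<Rightarrow> real \<Rightarrow> 'a measure" where
  "obs_filtration M N t =
     sigma (space M)
       (\<Inter>u\<in>{t<..}. sigma_sets (space M) (natural_generators M N {0..u} \<union> null_sets M))"

definition full_filtration ::
    "'a measure \<Rightarrow> (real \<Rightarrow> 'a \<Rightarrow> nat) \<Rightarrow> ('a \<Rightarrow> real) \<Rightarrow> ('a \<Rightarrow> real) \<Rightarrow> real \<Rightarrow> 'a measure" where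
  "full_filtration M N \<theta> \<Lambda> t =
     sigma (space M) (sets (obs_filtration M N t) \<union> rv_sets M \<theta> \<union> rv_sets M \<Lambda>)"

locale poisson_disorder = poisson_process M N \<mu>
  for M :: "'a measure" and N :: "real \<Rightarrow> 'a \<Rightarrow> nat" and \<mu> :: real +
  fixes \<theta> \<Lambda> :: "'a \<Rightarrow> real" and lam p0 :: real and \<nu> :: "real measure"
  assumes theta_rv: "random_variable borel \<theta>"
    and Lambda_rv: "random_variable borel \<Lambda>"
    and independent:
      "indep_sets ((!) [sigma_sets (space M) (natural_generators M N {0..}), rv_sets M \<theta>, rv_sets M \<Lambda>])
        {..<3}"
    and Lambda_distr: "distr M borel \<Lambda> = \<nu>"
    and moments: "\<And>k::nat. integrable \<nu> (\<lambda>v. (v - \<mu>) ^ k)"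
    and lam_pos: "lam > 0"
    and p0_range: "0 \<le> p0" "p0 < 1"
    and theta_zero: "prob {\<omega> \<in> space M. \<theta> \<omega> = 0} = p0"
    and theta_tail: "\<And>t. 0 \<le> t \<Longrightarrow> prob {\<omega> \<in> space M. \<theta> \<omega> > t} = (1 - p0) * exp (- lam * t)"

definition rate :: "real \<Rightarrow> ('a \<Rightarrow> real) \<Rightarrow> ('a \<Rightarrow> real) \<Rightarrow> real \<Rightarrow> 'a \<Rightarrow> real" where
  "rate \<mu> \<theta> \<Lambda> t \<omega> = (if t < \<theta> \<omega> then \<mu> else \<Lambda> \<omega>)"

text \<open>The integral with respect to \<open>dN\<close> is the pathwise Lebesgue--Stieltjes integral over \<open>(0, t]\<close>;
  the path of \<open>N\<close> is extended by \<open>N\<^sub>0\<close> to negative times, which creates no mass there.\<close>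

definition likelihood ::
    "(real \<Rightarrow> 'a \<Rightarrow> nat) \<Rightarrow> real \<Rightarrow> ('a \<Rightarrow> real) \<Rightarrow> ('a \<Rightarrow> real) \<Rightarrow> real \<Rightarrow> 'a \<Rightarrow> real" where
  "likelihood N \<mu> \<theta> \<Lambda> t \<omega> =
     exp ((LINT s:{0<..t}|interval_measure (\<lambda>s. real (N (max 0 s) \<omega>)).
             ln (Lim (at_left s) (\<lambda>r. rate \<mu> \<theta> \<Lambda> r \<omega>) / \<mu>))
          - (LINT s:{0..t}|lborel. rate \<mu> \<theta> \<Lambda> s \<omega> - \<mu>))"

text \<open>The measure \<open>P\<close> is represented by its restrictions to the \<open>\<sigma>\<close>-algebras \<open>G\<^sub>t\<close>, which is what the
  change of measure specifies and all that the conditional expectations below involve. These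
  restrictions need not extend to one measure on the \<open>\<sigma>\<close>-algebra generated by all \<open>G\<^sub>t\<close>:
  every null set of \<open>M\<close> belongs to \<open>G\<^sub>0\<close>, so an extension would be absolutely continuous with
  respect to \<open>M\<close>, whereas the long-run frequency of jumps of \<open>N\<close> is \<open>\<mu>\<close> under \<open>P\<^sub>0\<close> and
  \<open>\<Lambda>\<close> under \<open>P\<close>. Assuming a single \<open>P\<close> would thus be contradictory as soon as \<open>\<Lambda> \<noteq> \<mu>\<close> with
  positive probability.\<close>

definition disorder_measure ::
    "'a measure \<Rightarrow> (real \<Rightarrow> 'a \<Rightarrow> nat) \<Rightarrow> real \<Rightarrow> ('a \<Rightarrow> real) \<Rightarrow> ('a \<Rightarrow> real) \<Rightarrow> real \<Rightarrow> 'a measure" where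
  "disorder_measure M N \<mu> \<theta> \<Lambda> t =
     density (restr_to_subalg M (full_filtration M N \<theta> \<Lambda> t)) (\<lambda>\<omega>. ennreal (likelihood N \<mu> \<theta> \<Lambda> t \<omega>))"

definition disorder_cond_exp ::
    "'a measure \<Rightarrow> (real \<Rightarrow> 'a \<Rightarrow> nat) \<Rightarrow> real \<Rightarrow> ('a \<Rightarrow> real) \<Rightarrow> ('a \<Rightarrow> real) \<Rightarrow> real \<Rightarrow> ('a \<Rightarrow> real) \<Rightarrow> 'a \<Rightarrow> real"
  where
  "disorder_cond_exp M N \<mu> \<theta> \<Lambda> t f =
     real_cond_exp (disorder_measure M N \<mu> \<theta> \<Lambda> t) (obs_filtration M N t) f"

definition posterior_prob ::
    "'a measure \<Rightarrow> (real \<Rightarrow> 'a \<Rightarrow> nat) \<Rightarrow> real \<Rightarrow> ('a \<Rightarrow> real) \<Rightarrow> ('a \<Rightarrow> real) \<Rightarrow> real \<Rightarrow> 'a \<Rightarrow> real" where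
  "posterior_prob M N \<mu> \<theta> \<Lambda> t =
     disorder_cond_exp M N \<mu> \<theta> \<Lambda> t (indicator {\<omega>. \<theta> \<omega> \<le> t})"

text \<open>\<open>X\<close> is a right-continuous version of \<open>\<Phi>\<^sup>(\<^sup>k\<^sup>)\<close>. Adaptedness to the observation filtration is
  not required here.\<close>

definition odds_version ::
    "'a measure \<Rightarrow> (real \<Rightarrow> 'a \<Rightarrow> nat) \<Rightarrow> real \<Rightarrow> ('a \<Rightarrow> real) \<Rightarrow> ('a \<Rightarrow> real) \<Rightarrow> nat \<Rightarrow>
      (real \<Rightarrow> 'a \<Rightarrow> real) \<Rightarrow> bool" where
  "odds_version M N \<mu> \<theta> \<Lambda> k X \<longleftrightarrow>
     (\<forall>t\<ge>0. X t \<in> borel_measurable M) \<and>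
     (AE \<omega> in M. \<forall>t\<ge>0. continuous (at_right t) (\<lambda>s. X s \<omega>)) \<and>
     (\<forall>t\<ge>0. AE \<omega> in M.
        X t \<omega> =
          disorder_cond_exp M N \<mu> \<theta> \<Lambda> t (\<lambda>\<omega>'. (\<Lambda> \<omega>' - \<mu>) ^ k * indicator {\<omega>. \<theta> \<omega> \<le> t} \<omega>') \<omega>
            / (1 - posterior_prob M N \<mu> \<theta> \<Lambda> t \<omega>))"

definition adapted_process :: "(real \<Rightarrow> 'a measure) \<Rightarrow> (real \<Rightarrow> 'a \<Rightarrow> 'b) \<Rightarrow> 'b measure \<Rightarrow> bool" where
  "adapted_process F X S \<longleftrightarrow> (\<forall>t\<ge>0. X t \<in> measurable (F t) S)"

definition markov_process ::
    "'a measure \<Rightarrow> (real \<Rightarrow> 'a measure) \<Rightarrow> (real \<Rightarrow> 'a \<Rightarrow> 'b) \<Rightarrow> 'b measure \<Rightarrow> bool" where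
  "markov_process M F X S \<longleftrightarrow>
     adapted_process F X S \<and>
     (\<forall>s\<ge>0. \<forall>t\<ge>s. \<forall>B\<in>sets S. AE \<omega> in M.
        real_cond_exp M (F s) (indicator (X t -` B \<inter> space M)) \<omega> =
        real_cond_exp M (vimage_algebra (space M) (X s) S) (indicator (X t -` B \<inter> space M)) \<omega>)"

text \<open>The finite family \<open>(X i)\<^bsub>i \<in> I\<^esub>\<close>, read jointly as a process in \<open>\<real>\<^sup>I\<close>; \<open>\<Phi>0\<close> is the process
  \<open>\<Phi>\<^sup>(\<^sup>0\<^sup>)\<close> through which the observed data enter the Bayes risk.\<close>

definition sufficient_markov_statistic ::
    "'a measure \<Rightarrow> (real \<Rightarrow> 'a measure) \<Rightarrow> (real \<Rightarrow> 'a \<Rightarrow> real) \<Rightarrow> 'i set \<Rightarrow>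
      ('i \<Rightarrow> real \<Rightarrow> 'a \<Rightarrow> real) \<Rightarrow> bool" where
  "sufficient_markov_statistic M F \<Phi>0 I X \<longleftrightarrow>
     finite I \<and>
     (\<forall>i\<in>I. adapted_process F (X i) borel) \<and>
     (\<exists>i\<in>I. X i = \<Phi>0) \<and>
     markov_process M F (\<lambda>t \<omega>. \<lambda>i\<in>I. X i t \<omega>) (\<Pi>\<^sub>M i\<in>I. borel)"

end

theory Submission
  imports Defs
begin

text \<open>
  The likelihood process depends on the path of \<open>N\<close> only through the increments after \<open>\<theta>\<close>:
  almost surely \<open>Z\<^sub>t\<close> is the likelihood ratio of a Poisson process of rate \<open>\<Lambda>\<close> against one of rate
  \<open>\<mu>\<close> on \<open>(\<theta> \<and> t, t]\<close>. By Bayes' formula, and as \<open>(\<theta>, \<Lambda>)\<close> is independent of \<open>F\<^sub>t\<close> under \<open>P\<^sub>0\<close>,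
  \<open>\<Phi>\<^sup>(\<^sup>i\<^sup>)\<^sub>t\<close> is a deterministic multiple of \<open>\<Sum>\<^sub>v (v - \<mu>)\<^sup>i W\<^sup>v\<^sub>t\<close>, where \<open>v\<close> runs through the finitely many
  values of \<open>\<Lambda>\<close> and \<open>W\<^sup>v\<^sub>t\<close> integrates the likelihood ratio over the law of \<open>\<theta>\<close> on \<open>{\<Lambda> = v, \<theta> \<le> t}\<close>.
  As \<open>p(v - \<mu>) = 0\<close> for each such \<open>v\<close>, the linear relation follows at every fixed time, and
  then at all times by right continuity.

  By Lagrange interpolation the vector \<open>(\<Phi>\<^sup>(\<^sup>0\<^sup>), \<dots>, \<Phi>\<^sup>(\<^sup>k\<^sup>-\<^sup>1\<^sup>))\<close> at time \<open>s\<close> determines all \<open>W\<^sup>v\<^sub>s\<close>. Splitting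
  \<open>{\<theta> \<le> t}\<close> at \<open>s\<close> shows that \<open>W\<^sup>v\<^sub>t\<close> is an affine function of \<open>W\<^sup>v\<^sub>s\<close> whose coefficients depend only on
  increments of \<open>N\<close> after \<open>s\<close>. These are independent of the right-continuous enlargement \<open>F\<^sub>s\<close>,
  which gives the Markov property.
\<close>

section \<open>Conditional expectations and interpolation\<close>

text \<open>Time is rounded up to a grid of mesh \<open>1 / Suc n\<close>. For fixed
  \<open>n\<close> only countably many times occur, which gives joint measurability; right
  continuity recovers the process in the limit.\<close>

lemma borel_measurable_right_continuous_pair:
  fixes f :: "real \<Rightarrow> 'a \<Rightarrow> real"
  assumes meas: "\<And>r. a \<le> r \<Longrightarrow> r \<le> b \<Longrightarrow> f r \<in> borel_measurable F"
    and rc: "\<And>r \<omega>. \<omega> \<in> space F \<Longrightarrow> a \<le> r \<Longrightarrow> r < b \<Longrightarrow> continuous (at_right r) (\<lambda>s. f s \<omega>)"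
    and ab: "a \<le> b"
  shows "(\<lambda>(\<omega>, r). f (max a (min r b)) \<omega>) \<in> borel_measurable (F \<Otimes>\<^sub>M borel)"
proof -
  \<comment> \<open>The \<open>+ 1\<close> after rounding down puts the grid point strictly to the
    right of the time it replaces, as limits from the right require.\<close>
  define q where "q n j = max a (min b ((real_of_int j + 1) / real (Suc n)))" for n :: nat and j :: int
  define g where "g n x = f (q n \<lfloor>real (Suc n) * snd x\<rfloor>) (fst x)" for n and x :: "'a \<times> real"
  have "g n \<in> borel_measurable (F \<Otimes>\<^sub>M borel)" for n
    unfolding g_def
  proof (rule measurable_compose_countable'[where I = UNIV and f = "\<lambda>j x. f (q n j) (fst x)"
        and g = "\<lambda>x. \<lfloor>real (Suc n) * snd x\<rfloor>"])
    fix j show "(\<lambda>x. f (q n j) (fst x)) \<in> borel_measurable (F \<Otimes>\<^sub>M borel)"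
      by (rule measurable_compose[OF measurable_fst meas]) (use ab in \<open>auto simp: q_def\<close>)
  qed auto
  moreover have "(\<lambda>n. g n x) \<longlonglongrightarrow> (case x of (\<omega>, r) \<Rightarrow> f (max a (min r b)) \<omega>)"
    if "x \<in> space (F \<Otimes>\<^sub>M borel)" for x
  proof -
    obtain \<omega> r where x: "x = (\<omega>, r)" by fastforce
    have \<omega>: "\<omega> \<in> space F" using that by (auto simp: x space_pair_measure)
    define p where "p n = (real_of_int \<lfloor>real (Suc n) * r\<rfloor> + 1) / real (Suc n)" for n
    have p_gt: "p n > r" for n
    proof -
      have "r * real (Suc n) < real_of_int \<lfloor>real (Suc n) * r\<rfloor> + 1" by (subst mult.commute) linarith
      thus ?thesis unfolding p_def by (subst pos_less_divide_eq) auto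
    qed
    have p_le: "p n \<le> r + inverse (real (Suc n))" for n
    proof -
      have "real_of_int \<lfloor>real (Suc n) * r\<rfloor> + 1 \<le> real (Suc n) * r + 1" by linarith
      hence "p n \<le> (real (Suc n) * r + 1) / real (Suc n)" unfolding p_def by (intro divide_right_mono) auto
      also have "\<dots> = r + inverse (real (Suc n))" by (simp add: field_simps)
      finally show ?thesis .
    qed
    have lim: "p \<longlonglongrightarrow> r"
    proof (rule tendsto_sandwich[of "\<lambda>_. r" _ _ "\<lambda>n. r + inverse (real (Suc n))"])
      show "(\<lambda>n. r + inverse (real (Suc n))) \<longlonglongrightarrow> r"
        using tendsto_add[OF tendsto_const[of r] LIMSEQ_inverse_real_of_nat] by simp
    qed (use p_gt p_le in \<open>auto intro: less_imp_le always_eventually\<close>)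
    have g_eq: "g n x = f (max a (min b (p n))) \<omega>" for n by (simp add: g_def q_def p_def x)
    consider "r < a" | "r \<ge> b" | "a \<le> r" "r < b" by linarith
    thus ?thesis
    proof cases
      case 1
      have "eventually (\<lambda>n. p n < a) sequentially" using lim 1 by (rule order_tendstoD)
      hence "eventually (\<lambda>n. g n x = f a \<omega>) sequentially"
        by eventually_elim (simp add: g_eq max_def min_def)
      thus ?thesis using 1 ab by (auto simp: x max_def min_def intro: tendsto_eventually)
    next
      case 2
      have "g n x = f b \<omega>" for n using 2 p_gt[of n] ab by (auto simp: g_eq max_def min_def)
      thus ?thesis using 2 ab by (auto simp: x max_def min_def)
    next
      case 3
      have "eventually (\<lambda>n. p n < b) sequentially" using lim 3 by (auto dest: order_tendstoD)
      hence ev: "eventually (\<lambda>n. g n x = f (p n) \<omega>) sequentially"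
        proof eventually_elim
        case (elim n)
        show ?case using 3 p_gt[of n] elim by (simp add: g_eq max_def min_def)
      qed
      have "filterlim p (at_right r) sequentially"
        unfolding filterlim_at using lim p_gt by (auto intro: always_eventually)
      moreover have "((\<lambda>s. f s \<omega>) \<longlongrightarrow> f r \<omega>) (at_right r)"
        using rc[OF \<omega> 3] by (simp add: continuous_within)
      ultimately have "(\<lambda>n. f (p n) \<omega>) \<longlonglongrightarrow> f r \<omega>"
        by (rule filterlim_compose[rotated])
      hence "(\<lambda>n. g n x) \<longlonglongrightarrow> f r \<omega>" using ev by (simp add: tendsto_cong)
      thus ?thesis using 3 by (simp add: x)
    qed
  qed
  ultimately show ?thesis by (rule borel_measurable_LIMSEQ_real[rotated])
qed

text \<open>The law of the identity into \<open>H\<close> is a probability measure with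
  sigma-algebra \<open>H\<close>, to which the usual measurability of partial integrals
  applies.\<close>

lemma (in prob_space) borel_measurable_expectation_pair:
  fixes \<phi> :: "'b \<Rightarrow> 'a \<Rightarrow> real"
  assumes H: "subalgebra M H" and \<phi>: "(\<lambda>(x, y). \<phi> x y) \<in> borel_measurable (F \<Otimes>\<^sub>M H)"
  shows "(\<lambda>x. \<integral>y. \<phi> x y \<partial>M) \<in> borel_measurable F"
proof -
  let ?H = "distr M H (\<lambda>x. x)"
  have id: "(\<lambda>x. x) \<in> M \<rightarrow>\<^sub>M H" using H by (auto simp: subalgebra_def measurable_def)
  interpret H: prob_space ?H by (rule prob_space_distr) (rule id)
  have "(\<lambda>x. \<integral>y. \<phi> x y \<partial>?H) \<in> borel_measurable F"
    by (rule H.borel_measurable_lebesgue_integral) (use \<phi> in \<open>simp cong: measurable_cong_sets sets_pair_measure_cong\<close>)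
  thus ?thesis
    by (rule measurable_cong[THEN iffD1, rotated])
       (subst integral_distr[OF id], use measurable_Pair2[OF \<phi>] in auto)
qed

text \<open>The identity map, read as a map into the space with \<open>\<sigma>\<close>-algebra \<open>F\<close> (or \<open>H\<close>), serves as a random
  variable, so that \<open>\<phi>\<close> can be any jointly measurable function of two independent \<open>\<sigma>\<close>-algebras.\<close>

lemma (in prob_space) real_cond_exp_indep:
  fixes \<phi> :: "'a \<Rightarrow> 'a \<Rightarrow> real"
  assumes F: "subalgebra M F" and H: "subalgebra M H"
    and indep: "indep_set (sets F) (sets H)"
    and \<phi>: "(\<lambda>(x, y). \<phi> x y) \<in> borel_measurable (F \<Otimes>\<^sub>M H)"
    and int: "integrable M (\<lambda>x. \<phi> x x)"
  shows "integrable M (\<lambda>x. \<integral>y. \<phi> x y \<partial>M)"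
    and "(\<lambda>x. \<integral>y. \<phi> x y \<partial>M) \<in> borel_measurable F"
    and "AE x in M. real_cond_exp M F (\<lambda>x. \<phi> x x) x = (\<integral>y. \<phi> x y \<partial>M)"
proof -
  let ?F = "distr M F (\<lambda>x. x)" and ?H = "distr M H (\<lambda>x. x)"
  have sp: "space F = space M" "space H = space M"
    using F H by (auto simp: subalgebra_def)
  have [measurable]: "(\<lambda>x. x) \<in> M \<rightarrow>\<^sub>M F" "(\<lambda>x. x) \<in> M \<rightarrow>\<^sub>M H"
    using F H by (auto simp: subalgebra_def measurable_def)
  have gen: "sigma_sets (space M) {(\<lambda>x. x) -` A \<inter> space M |A. A \<in> sets G} = sets G"
    if "space G = space M" for G
  proof -
    have "{(\<lambda>x. x) -` A \<inter> space M |A. A \<in> sets G} = sets G"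
      using sets.sets_into_space[of _ G] that by (auto simp: Int_absorb2)
    thus ?thesis using sets.sigma_sets_eq[of G] that by simp
  qed
  have "indep_var F (\<lambda>x. x) H (\<lambda>x. x)"
    unfolding indep_var_eq using indep using gen[of F] gen[of H] by (simp add: sp)
  \<comment> \<open>By independence the diagonal map has a product law, so integrals of
    \<open>\<phi> x x\<close> become double integrals.\<close>
  hence prod: "?F \<Otimes>\<^sub>M ?H = distr M (F \<Otimes>\<^sub>M H) (\<lambda>x. (x, x))"
    by (simp add: indep_var_distribution_eq)
  interpret F: prob_space ?F by (rule prob_space_distr) simp
  interpret H: prob_space ?H by (rule prob_space_distr) simp
  interpret P: pair_prob_space ?F ?H ..
  have [measurable]: "(\<lambda>(x, y). \<phi> x y) \<in> borel_measurable (?F \<Otimes>\<^sub>M ?H)"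
    using \<phi> by (simp cong: measurable_cong_sets sets_pair_measure_cong)
  have inner: "(\<integral>y. \<phi> x y \<partial>?H) = (\<integral>y. \<phi> x y \<partial>M)" if "x \<in> space M" for x
    using that sp \<phi> by (subst integral_distr) (auto intro: measurable_Pair2[where f = "case_prod \<phi>", simplified])
  have ipair: "integrable (?F \<Otimes>\<^sub>M ?H) (\<lambda>(x, y). \<phi> x y)"
    unfolding prod by (subst integrable_distr_eq) (use \<phi> int in auto)
  have psi_meas': "(\<lambda>x. \<integral>y. \<phi> x y \<partial>?H) \<in> borel_measurable F"
    using H.borel_measurable_lebesgue_integral[of "\<phi>" ?F] by simp
  show psi_meas: "(\<lambda>x. \<integral>y. \<phi> x y \<partial>M) \<in> borel_measurable F"
    by (rule borel_measurable_expectation_pair[OF H \<phi>])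
  have "integrable ?F (\<lambda>x. \<integral>y. \<phi> x y \<partial>?H)"
    using P.integrable_fst'[OF ipair] by simp
  hence "integrable M (\<lambda>x. \<integral>y. \<phi> x y \<partial>?H)"
    by (rule integrable_distr[rotated]) simp
  thus psi_int: "integrable M (\<lambda>x. \<integral>y. \<phi> x y \<partial>M)"
    by (rule Bochner_Integration.integrable_cong[THEN iffD1, rotated 2]) (auto simp: inner)
  interpret S: finite_measure_subalgebra M F by unfold_locales (rule F)
  show "AE x in M. real_cond_exp M F (\<lambda>x. \<phi> x x) x = (\<integral>y. \<phi> x y \<partial>M)"
  proof (rule S.real_cond_exp_charact[OF _ int psi_int psi_meas])
    fix A assume A[measurable]: "A \<in> sets F"
    \<comment> \<open>Integrability for Fubini's theorem; the indicator of \<open>A\<close> involves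
      only the first coordinate and then leaves the inner integral.\<close>
    have iA: "integrable (?F \<Otimes>\<^sub>M ?H) (\<lambda>(x, y). indicator A x * \<phi> x y)"
      by (rule Bochner_Integration.integrable_bound[OF ipair])
         (auto simp: indicator_def split: prod.split)
    have "(\<integral>x\<in>A. \<phi> x x \<partial>M) = (\<integral>z. (case z of (x, y) \<Rightarrow> indicator A x * \<phi> x y) \<partial>(?F \<Otimes>\<^sub>M ?H))"
      unfolding prod by (subst integral_distr) (use \<phi> in \<open>auto simp: set_lebesgue_integral_def\<close>)
    also have "\<dots> = (\<integral>x. (\<integral>y. indicator A x * \<phi> x y \<partial>?H) \<partial>?F)"
      using P.integral_fst'[OF iA] by simp
    also have "\<dots> = (\<integral>x. indicator A x * (\<integral>y. \<phi> x y \<partial>?H) \<partial>?F)" by simp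
    also have "\<dots> = (\<integral>x. indicator A x * (\<integral>y. \<phi> x y \<partial>?H) \<partial>M)"
      by (subst integral_distr) (use psi_meas' in auto)
    also have "\<dots> = (\<integral>x\<in>A. (\<integral>y. \<phi> x y \<partial>M) \<partial>M)"
      unfolding set_lebesgue_integral_def
      by (rule Bochner_Integration.integral_cong) (auto simp: inner)
    finally show "(\<integral>x\<in>A. \<phi> x x \<partial>M) = (\<integral>x\<in>A. (\<integral>y. \<phi> x y \<partial>M) \<partial>M)" .
  qed
qed

text \<open>Bayes' formula for a change of measure with density \<open>Z\<close>. The constant
  \<open>C\<close> bounds the quotient, which makes it integrable under the new measure.\<close>

lemma (in prob_space) real_cond_exp_density_subalg:
  assumes F: "subalgebra G F" and G: "subalgebra M G"
    and Z: "Z \<in> borel_measurable G" "\<And>x. 0 < Z x" "integrable M Z"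
    and f: "f \<in> borel_measurable G" "integrable M (\<lambda>x. Z x * f x)"
    and p: "p \<in> borel_measurable F" "AE x in M. real_cond_exp M F (\<lambda>x. Z x * f x) x = p x"
    and q: "q \<in> borel_measurable F" "AE x in M. real_cond_exp M F Z x = q x" "\<And>x. 0 < q x"
    and C: "\<And>x. \<bar>p x\<bar> \<le> C * q x"
  shows "AE x in M. real_cond_exp (density (restr_to_subalg M G) (\<lambda>x. ennreal (Z x))) F f x = p x / q x"
proof -
  let ?R = "restr_to_subalg M G" and ?D = "density (restr_to_subalg M G) (\<lambda>x. ennreal (Z x))"
  have MF: "subalgebra M F" using F G by (auto simp: subalgebra_def)
  have sR[measurable_cong]: "sets ?R = sets G" by (rule sets_restr_to_subalg[OF G])
  have [measurable]: "Z \<in> borel_measurable G" "f \<in> borel_measurable G" by fact+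
  have FG: "h \<in> borel_measurable G" if "h \<in> borel_measurable F" for h :: "'a \<Rightarrow> real"
    using that F measurable_from_subalg by blast
  have GM: "h \<in> borel_measurable M" if "h \<in> borel_measurable G" for h :: "'a \<Rightarrow> real"
    using that G measurable_from_subalg by blast
  have pqG[measurable]: "p \<in> borel_measurable G" "q \<in> borel_measurable G"
    using FG[OF p(1)] FG[OF q(1)] .
  have [measurable]: "p \<in> borel_measurable M" "q \<in> borel_measurable M" "Z \<in> borel_measurable M" "f \<in> borel_measurable M"
    using GM[OF pqG(1)] GM[OF pqG(2)] GM[OF Z(1)] GM[OF f(1)] .
  interpret S: finite_measure_subalgebra M F by unfold_locales (rule MF)
  have ZR: "integrable ?R Z" by (rule integrable_in_subalg[OF G Z(1,3)])
  have "emeasure ?D (space ?D) = (\<integral>\<^sup>+x. ennreal (Z x) \<partial>?R)"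
    by (subst emeasure_density) (auto intro!: nn_integral_cong simp: indicator_def)
  also have "\<dots> < \<infinity>"
    using ZR Z(2) by (auto simp: integrable_iff_bounded less_imp_le)
  finally have "finite_measure ?D" by (intro finite_measureI) auto
  moreover have "subalgebra ?D F" using F G by (auto simp: subalgebra_def space_restr_to_subalg sR)
  ultimately interpret D: finite_measure_subalgebra ?D F
    by (intro finite_measure_subalgebra.intro finite_measure_subalgebra_axioms.intro)
  have int_D: "(\<integral>x. h x \<partial>?D) = (\<integral>x. Z x * h x \<partial>M)" if [measurable]: "h \<in> borel_measurable G" for h :: "'a \<Rightarrow> real"
  proof -
    have "(\<integral>x. h x \<partial>?D) = (\<integral>x. Z x * h x \<partial>?R)"
      by (subst integral_density) (auto simp: Z(2) less_imp_le)
    also have "\<dots> = (\<integral>x. Z x * h x \<partial>M)" by (rule integral_subalgebra2[OF G]) simp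
    finally show ?thesis .
  qed
  have integrable_D: "integrable ?D h" if [measurable]: "h \<in> borel_measurable G" and "integrable M (\<lambda>x. Z x * h x)" for h :: "'a \<Rightarrow> real"
  proof -
    have "integrable ?R (\<lambda>x. Z x * h x)" by (rule integrable_in_subalg[OF G]) (use that in auto)
    thus ?thesis by (subst integrable_density) (auto simp: Z(2) less_imp_le)
  qed
  have pq_le: "\<bar>p x / q x\<bar> \<le> C" for x
    using C[of x] q(3)[of x] by (simp add: abs_divide pos_divide_le_eq)
  have C0: "0 \<le> C" using pq_le[of undefined] by linarith
  have Zpq: "integrable M (\<lambda>x. Z x * (p x / q x))"
  proof (rule Bochner_Integration.integrable_bound)
    show "integrable M (\<lambda>x. C * Z x)" using Z by simp
    have "norm (Z x * (p x / q x)) \<le> norm (C * Z x)" for x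
    proof -
      have "norm (Z x * (p x / q x)) = \<bar>p x / q x\<bar> * Z x"
        using Z(2)[of x] by (simp only: real_norm_def abs_mult) simp
      also have "\<dots> \<le> C * Z x" by (rule mult_right_mono[OF pq_le]) (use Z(2)[of x] in simp)
      finally show ?thesis by simp
    qed
    thus "AE x in M. norm (Z x * (p x / q x)) \<le> norm (C * Z x)" by (intro AE_I2)
  qed simp
  have "AE x in ?D. real_cond_exp ?D F f x = p x / q x"
  proof (rule D.real_cond_exp_charact)
    show "integrable ?D f" using f by (intro integrable_D) auto
    show "integrable ?D (\<lambda>x. p x / q x)" using Zpq by (intro integrable_D) auto
    show "(\<lambda>x. p x / q x) \<in> borel_measurable F" using p q by simp
    fix A assume A: "A \<in> sets F"
    hence AG[measurable]: "A \<in> sets G" and AM[measurable]: "A \<in> sets M" using F G by (auto simp: subalgebra_def)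
    have "(\<integral>x\<in>A. f x \<partial>?D) = (\<integral>x\<in>A. Z x * f x \<partial>M)"
      unfolding set_lebesgue_integral_def
      by (subst int_D) (auto intro!: Bochner_Integration.integral_cong)
    also have "\<dots> = (\<integral>x\<in>A. real_cond_exp M F (\<lambda>x. Z x * f x) x \<partial>M)"
      by (rule S.real_cond_exp_intA[OF f(2) A])
    also have "\<dots> = (\<integral>x\<in>A. p x \<partial>M)"
      by (rule set_lebesgue_integral_cong_AE) (use p in auto)
    \<comment> \<open>Multiplying and dividing by \<open>q\<close> brings in the conditional
      expectation of \<open>Z\<close>; as the other factor is \<open>F\<close>-measurable, it may be
      exchanged for \<open>Z\<close> itself.\<close>
    also have "\<dots> = (\<integral>x. (indicator A x * (p x / q x)) * q x \<partial>M)"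
      unfolding set_lebesgue_integral_def
    proof (rule Bochner_Integration.integral_cong)
      fix x show "indicator A x *\<^sub>R p x = (indicator A x * (p x / q x)) * q x"
        using q(3)[of x] by simp
    qed simp
    also have "\<dots> = (\<integral>x. (indicator A x * (p x / q x)) * real_cond_exp M F Z x \<partial>M)"
      by (rule integral_cong_AE) (use q in auto)
    also have "\<dots> = (\<integral>x. (indicator A x * (p x / q x)) * Z x \<partial>M)"
    proof (rule S.real_cond_exp_intg(2))
      show "(\<lambda>x. indicator A x * (p x / q x)) \<in> borel_measurable F" using p q A by measurable
      show "integrable M (\<lambda>x. (indicator A x * (p x / q x)) * Z x)"
        by (rule Bochner_Integration.integrable_bound[OF Zpq]) (auto simp: indicator_def mult.commute)
    qed simp
    also have "\<dots> = (\<integral>x\<in>A. p x / q x \<partial>?D)"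
      unfolding set_lebesgue_integral_def
      by (subst int_D) (auto intro!: Bochner_Integration.integral_cong)
    finally show "(\<integral>x\<in>A. f x \<partial>?D) = (\<integral>x\<in>A. p x / q x \<partial>?D)" .
  qed
  \<comment> \<open>Since \<open>Z\<close> is strictly positive, null sets of the density are null
    for the restricted measure.\<close>
  hence "AE x in ?R. real_cond_exp ?D F f x = p x / q x"
    by (subst (asm) AE_density) (auto simp: Z(2))
  thus ?thesis by (rule AE_restr_to_subalg[OF G])
qed

text \<open>The Lagrange basis polynomial for the nodes \<open>u - m\<close>. Its degree bound is
  why \<open>card V\<close> moments suffice to isolate one weight.\<close>

lemma ex_interpolation_poly:
  fixes V :: "real set" and m :: real
  assumes "finite V" "v \<in> V"
  shows "\<exists>P. degree P < card V \<and> (\<forall>w\<in>V. poly P (w - m) = (if w = v then 1 else 0))"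
proof -
  define P where "P = (\<Prod>u\<in>V - {v}. smult (1 / (v - u)) [:- (u - m), 1:])"
  have "degree P \<le> (\<Sum>u\<in>V - {v}. degree (smult (1 / (v - u)) [:- (u - m), 1:]))"
    unfolding P_def using degree_prod_sum_le[of "V - {v}" "\<lambda>u. smult (1 / (v - u)) [:- (u - m), 1:]"] assms
    unfolding P_def comp_def by blast
  also have "\<dots> \<le> (\<Sum>u\<in>V - {v}. 1)" by (intro sum_mono) auto
  also have "\<dots> < card V" using assms card_Diff1_less[of V v] by simp
  finally have "degree P < card V" .
  moreover have "poly P (w - m) = (if w = v then 1 else 0)" if "w \<in> V" for w
  proof (cases "w = v")
    case True
    have "poly P (w - m) = (\<Prod>u\<in>V - {v}. 1)" unfolding P_def poly_prod
    proof (rule prod.cong)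
      fix u assume "u \<in> V - {v}"
      hence "v - u \<noteq> 0" by simp
      moreover have "poly (smult (1 / (v - u)) [:- (u - m), 1:]) (w - m) = (v - u) / (v - u)"
        unfolding True by (simp add: diff_divide_distrib[symmetric] add_divide_distrib[symmetric])
      ultimately show "poly (smult (1 / (v - u)) [:- (u - m), 1:]) (w - m) = 1" by simp
    qed simp
    thus ?thesis using True by simp
  next
    case False
    hence "\<exists>u\<in>V - {v}. poly (smult (1 / (v - u)) [:- (u - m), 1:]) (w - m) = 0"
      using that by (intro bexI[of _ w]) (auto simp: add_divide_distrib[symmetric])
    thus ?thesis using False assms unfolding P_def poly_prod by (simp add: prod_zero_iff)
  qed
  ultimately show ?thesis by blast
qed

text \<open>No measurability is required, so this applies to \<^const>\<open>likelihood\<close>, which is understood only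
  almost everywhere.\<close>

lemma density_cong_AE:
  assumes "AE x in M. f x = g x"
  shows "density M f = density M g"
  unfolding density_def
proof (rule measure_of_eq)
  show "sets M \<subseteq> Pow (space M)" by (rule sets.space_closed)
  show "(\<integral>\<^sup>+ x. f x * indicator a x \<partial>M) = (\<integral>\<^sup>+ x. g x * indicator a x \<partial>M)" for a
    by (rule nn_integral_cong_AE) (use assms in auto)
qed

text \<open>Inverts the passage from weights to moments: after exchanging the sums, the coefficient
  of \<open>W w\<close> is \<open>poly P (w - m)\<close>.\<close>

lemma sum_interpolation_coeffs:
  fixes W :: "real \<Rightarrow> real" and m :: real
  assumes V: "finite V" "v \<in> V" and P: "degree P < k"
    and \<delta>: "\<And>w. w \<in> V \<Longrightarrow> poly P (w - m) = (if w = v then 1 else 0)"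
  shows "(\<Sum>j<k. coeff P j * (\<Sum>w\<in>V. (w - m) ^ j * W w)) = W v"
proof -
  have poly: "poly P x = (\<Sum>j<k. coeff P j * x ^ j)" for x
    unfolding poly_altdef
    by (rule sum.mono_neutral_left) (use P in \<open>auto simp: coeff_eq_0\<close>)
  have "(\<Sum>j<k. coeff P j * (\<Sum>w\<in>V. (w - m) ^ j * W w)) = (\<Sum>j<k. \<Sum>w\<in>V. coeff P j * (w - m) ^ j * W w)"
    by (simp add: sum_distrib_left mult.assoc)
  also have "\<dots> = (\<Sum>w\<in>V. \<Sum>j<k. coeff P j * (w - m) ^ j * W w)" by (rule sum.swap)
  also have "\<dots> = (\<Sum>w\<in>V. poly P (w - m) * W w)" by (simp add: poly sum_distrib_right)
  also have "\<dots> = (\<Sum>w\<in>V. if w = v then W w else 0)" by (intro sum.cong) (auto simp: \<delta>)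
  also have "\<dots> = W v" using V by simp
  finally show ?thesis .
qed

text \<open>A nonzero value would persist on an interval to the right, which contains a
  rational.\<close>

lemma right_continuous_eq_0:
  fixes D :: "real \<Rightarrow> real"
  assumes "\<And>s. s \<in> \<rat> \<Longrightarrow> t < s \<Longrightarrow> D s = 0" and "(D \<longlongrightarrow> D t) (at_right t)"
  shows "D t = 0"
proof (rule ccontr)
  assume "D t \<noteq> 0"
  hence "eventually (\<lambda>s. D s \<noteq> 0) (at_right t)" using assms(2) by (intro tendsto_imp_eventually_ne)
  then obtain b where "b > t" and b: "\<And>s. t < s \<Longrightarrow> s < b \<Longrightarrow> D s \<noteq> 0"
    by (auto simp: eventually_at_right_field)
  obtain r where "r \<in> \<rat>" "t < r" "r < b" using Rats_dense_in_real[OF \<open>b > t\<close>] by auto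
  thus False using assms(1) b by blast
qed

text \<open>Conditioning freezes \<open>X\<close>, and averaging over the independent
  \<open>H\<close> gives the same function of \<open>X\<close> whether the condition is
  \<open>F\<close> or only the sigma-algebra of \<open>X\<close>.\<close>

lemma (in prob_space) markov_transition:
  assumes F: "subalgebra M F" and H: "subalgebra M H" and indep: "indep_set (sets F) (sets H)"
    and X: "X \<in> F \<rightarrow>\<^sub>M S" and Y: "Y \<in> M \<rightarrow>\<^sub>M S"
    and G: "(\<lambda>(x, \<omega>). G x \<omega>) \<in> S \<Otimes>\<^sub>M H \<rightarrow>\<^sub>M S"
    and Y_eq: "AE \<omega> in M. Y \<omega> = G (X \<omega>) \<omega>"
    and B: "B \<in> sets S"
  shows "AE \<omega> in M. real_cond_exp M F (indicator (Y -` B \<inter> space M)) \<omega> =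
    real_cond_exp M (vimage_algebra (space M) X S) (indicator (Y -` B \<inter> space M)) \<omega>"
proof -
  let ?K = "vimage_algebra (space M) X S"
  define \<phi> :: "'a \<Rightarrow> 'a \<Rightarrow> real" where "\<phi> = (\<lambda>x y. indicator B (G (X x) y))"
  have XS: "X \<in> space M \<rightarrow> space S" using measurable_space[OF X] F by (auto simp: subalgebra_def)
  have KF: "sets ?K \<subseteq> sets F"
    using measurable_sets[OF X] F by (auto simp: sets_vimage_algebra2[OF XS] subalgebra_def)
  \<comment> \<open>One computation for every \<open>F'\<close> between the sigma-algebra of
    \<open>X\<close> and \<open>F\<close>; the right-hand side does not depend on
    \<open>F'\<close>.\<close>
  have *: "AE \<omega> in M. real_cond_exp M F' (indicator (Y -` B \<inter> space M)) \<omega> = (\<integral>y. \<phi> \<omega> y \<partial>M)"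
    if F': "subalgebra M F'" "X \<in> F' \<rightarrow>\<^sub>M S" "sets F' \<subseteq> sets F" for F'
  proof -
    have sp: "space F' = space M" "space H = space M" using F' H by (auto simp: subalgebra_def)
    have [measurable]: "X \<in> F' \<rightarrow>\<^sub>M S" by fact
    have "(\<lambda>z. G (X (fst z)) (snd z)) \<in> F' \<Otimes>\<^sub>M H \<rightarrow>\<^sub>M S"
      using measurable_compose[of "\<lambda>z. (X (fst z), snd z)" "F' \<Otimes>\<^sub>M H" "S \<Otimes>\<^sub>M H", OF _ G] by simp
    hence meas: "(\<lambda>(x, y). \<phi> x y) \<in> borel_measurable (F' \<Otimes>\<^sub>M H)"
      unfolding \<phi>_def case_prod_beta using B by measurable
    have id: "(\<lambda>x. x) \<in> M \<rightarrow>\<^sub>M F'" "(\<lambda>x. x) \<in> M \<rightarrow>\<^sub>M H"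
      using F' H by (auto simp: subalgebra_def measurable_def)
    have diag: "(\<lambda>x. \<phi> x x) \<in> borel_measurable M"
      using measurable_compose[OF measurable_Pair[OF id] meas] by simp
    have "integrable M (\<lambda>x. \<phi> x x)"
      by (rule integrable_const_bound[of _ 1]) (use diag in \<open>auto simp: \<phi>_def\<close>)
    moreover have "indep_set (sets F') (sets H)" using indep F'(3) unfolding indep_sets2_eq by auto
    ultimately have "AE x in M. real_cond_exp M F' (\<lambda>x. \<phi> x x) x = (\<integral>y. \<phi> x y \<partial>M)"
      using real_cond_exp_indep[OF F'(1) H _ meas] by blast
    moreover interpret S: finite_measure_subalgebra M F' by unfold_locales (rule F')
    have "AE x in M. real_cond_exp M F' (indicator (Y -` B \<inter> space M)) x = real_cond_exp M F' (\<lambda>x. \<phi> x x) x"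
      by (rule S.real_cond_exp_cong)
         (use Y_eq Y B diag in \<open>auto simp: \<phi>_def indicator_def intro: measurable_sets elim!: AE_mp\<close>)
    ultimately show ?thesis by auto
  qed
  have "subalgebra M ?K" using KF F by (auto simp: subalgebra_def)
  hence "AE \<omega> in M. real_cond_exp M ?K (indicator (Y -` B \<inter> space M)) \<omega> = (\<integral>y. \<phi> \<omega> y \<partial>M)"
    by (rule *) (use KF measurable_vimage_algebra1[OF XS] in auto)
  with *[OF F X order_refl] show ?thesis by auto
qed

section \<open>Independence of past and future increments\<close>

text \<open>Each set of the enlarged sigma-algebra agrees almost surely with a set of the original
  one, so the product rule is inherited.\<close>

lemma (in prob_space) indep_set_null_sets:
  assumes G: "G \<subseteq> Pow (space M)" and indep: "indep_set (sigma_sets (space M) G) B"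
  shows "indep_set (sigma_sets (space M) (G \<union> null_sets M)) B"
proof -
  have G_ev: "sigma_sets (space M) G \<subseteq> events" using indep by (rule indep_setD_ev1)
  have *: "\<exists>C'\<in>sigma_sets (space M) G. C \<in> events \<and> (AE x in M. x \<in> C \<longleftrightarrow> x \<in> C')"
    if "C \<in> sigma_sets (space M) (G \<union> null_sets M)" for C
    using that
  proof induction
    case (Basic a)
    show ?case
    proof (cases "a \<in> G")
      case True
      thus ?thesis using G_ev by (intro bexI[of _ a]) auto
    next
      case False
      with Basic have "a \<in> null_sets M" by simp
      thus ?thesis using AE_not_in[of a M]
        by (intro bexI[of _ "{}"]) (auto intro: sigma_sets.Empty)
    qed
  next
    case Empty
    show ?case by (intro bexI[of _ "{}"]) (auto intro: sigma_sets.Empty)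
  next
    case (Compl a)
    then obtain a' where a': "a' \<in> sigma_sets (space M) G" "a \<in> events" "AE x in M. x \<in> a \<longleftrightarrow> x \<in> a'" by auto
    show ?case
      using a' by (intro bexI[of _ "space M - a'"]) (auto intro: sigma_sets.Compl)
  next
    case (Union a)
    then obtain a' where a': "\<And>i. a' i \<in> sigma_sets (space M) G" "\<And>i. a i \<in> events"
      "\<And>i. AE x in M. x \<in> a i \<longleftrightarrow> x \<in> a' i" by metis
    have "AE x in M. \<forall>i::nat. x \<in> a i \<longleftrightarrow> x \<in> a' i" using a'(3) by (simp add: AE_all_countable)
    hence "AE x in M. x \<in> (\<Union>i. a i) \<longleftrightarrow> x \<in> (\<Union>i. a' i)" by eventually_elim auto
    thus ?case using a' by (intro bexI[of _ "\<Union>i. a' i"]) (auto intro: sigma_sets.Union)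
  qed
  show ?thesis
  proof (rule indep_setI)
    show "B \<subseteq> events" using indep by (rule indep_setD_ev2)
    show "sigma_sets (space M) (G \<union> null_sets M) \<subseteq> events" using * by blast
    fix a b assume "a \<in> sigma_sets (space M) (G \<union> null_sets M)" and b: "b \<in> B"
    with * obtain a' where a': "a' \<in> sigma_sets (space M) G" "a \<in> events" "AE x in M. x \<in> a \<longleftrightarrow> x \<in> a'" by metis
    have ev: "a' \<in> events" "b \<in> events" using a' G_ev \<open>B \<subseteq> events\<close> b by auto
    have "prob (a \<inter> b) = prob (a' \<inter> b)"
      by (rule finite_measure_eq_AE) (use a' ev in auto)
    also have "\<dots> = prob a' * prob b" by (rule indep_setD[OF indep a'(1) b])
    also have "prob a' = prob a"
      by (rule finite_measure_eq_AE) (use a' ev in auto)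
    finally show "prob (a \<inter> b) = prob a * prob b" .
  qed
qed

text \<open>The set of times is arbitrary so as to cover finite sets as well as
  \<open>{0..r}\<close>, \<open>{r..}\<close> and \<open>{s<..}\<close>. For
  \<open>q \<le> u\<close> and monotone paths the truncated subtraction is the true one.\<close>

definition increment_algebra :: "'a measure \<Rightarrow> (real \<Rightarrow> 'a \<Rightarrow> nat) \<Rightarrow> real set \<Rightarrow> 'a measure" where
  "increment_algebra M N T = sigma (space M)
     {(\<lambda>\<omega>. N u \<omega> - N q \<omega>) -` A \<inter> space M | q u A. q \<in> T \<and> u \<in> T \<and> q \<le> u}"

lemma space_increment_algebra [simp]: "space (increment_algebra M N T) = space M"
  by (simp add: increment_algebra_def space_measure_of_conv)

lemma sets_increment_algebra:
  "sets (increment_algebra M N T) = sigma_sets (space M)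
     {(\<lambda>\<omega>. N u \<omega> - N q \<omega>) -` A \<inter> space M | q u A. q \<in> T \<and> u \<in> T \<and> q \<le> u}"
  unfolding increment_algebra_def by (rule sets_measure_of) auto

lemma measurable_increment_algebra:
  assumes "q \<in> T" "u \<in> T" "q \<le> u"
  shows "(\<lambda>\<omega>. N u \<omega> - N q \<omega>) \<in> measurable (increment_algebra M N T) (count_space UNIV)"
proof (rule measurableI)
  fix A :: "nat set"
  show "(\<lambda>\<omega>. N u \<omega> - N q \<omega>) -` A \<inter> space (increment_algebra M N T) \<in> sets (increment_algebra M N T)"
    unfolding sets_increment_algebra using assms by (intro sigma_sets.Basic) auto
qed auto

lemma sets_increment_algebra_le:
  assumes "\<And>q u. q \<in> T \<Longrightarrow> u \<in> T \<Longrightarrow> q \<le> u \<Longrightarrow> (\<lambda>\<omega>. N u \<omega> - N q \<omega>) \<in> measurable K (count_space UNIV)"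
    and "space K = space M"
  shows "sets (increment_algebra M N T) \<subseteq> sets K"
  unfolding sets_increment_algebra assms(2)[symmetric]
  by (rule sets.sigma_sets_subset) (use assms(1) in \<open>auto simp: measurable_sets\<close>)

lemma sets_increment_algebra_mono: "T \<subseteq> T' \<Longrightarrow> sets (increment_algebra M N T) \<subseteq> sets (increment_algebra M N T')"
  by (rule sets_increment_algebra_le) (auto intro: measurable_increment_algebra)

text \<open>Two members of the union lie in a common sigma-algebra. This supplies the pi-systems for
  extending independence to generated sigma-algebras.\<close>

lemma Int_stable_directed_UN:
  assumes "\<And>i j. i \<in> I \<Longrightarrow> j \<in> I \<Longrightarrow> \<exists>k\<in>I. sets (F i) \<subseteq> sets (F k) \<and> sets (F j) \<subseteq> sets (F k)"
  shows "Int_stable (\<Union>i\<in>I. sets (F i))"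
proof (rule Int_stableI)
  fix a b assume "a \<in> (\<Union>i\<in>I. sets (F i))" "b \<in> (\<Union>i\<in>I. sets (F i))"
  then obtain i j where ij: "i \<in> I" "j \<in> I" "a \<in> sets (F i)" "b \<in> sets (F j)" by auto
  with assms obtain k where "k \<in> I" "a \<in> sets (F k)" "b \<in> sets (F k)" by blast
  thus "a \<inter> b \<in> (\<Union>i\<in>I. sets (F i))" by auto
qed

section \<open>Increments of the Poisson process before and after a fixed time\<close>

context poisson_process
begin

lemma subalgebra_increment_algebra: "T \<subseteq> {0..} \<Longrightarrow> subalgebra M (increment_algebra M N T)"
  unfolding subalgebra_def
proof
  assume T: "T \<subseteq> {0..}"
  show "sets (increment_algebra M N T) \<subseteq> events"
  proof (rule sets_increment_algebra_le)
    fix q u assume "q \<in> T" "u \<in> T"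
    hence [measurable]: "N q \<in> measurable M (count_space UNIV)" "N u \<in> measurable M (count_space UNIV)"
      using T N_measurable by auto
    show "(\<lambda>\<omega>. N u \<omega> - N q \<omega>) \<in> measurable M (count_space UNIV)" by measurable
  qed simp
qed simp

text \<open>The consecutive increments along \<open>T\<close> are independent and form two blocks
  separated by \<open>r\<close>; all other increments telescope into those of one block.\<close>

lemma indep_increments_finite:
  assumes T: "finite T" "T \<subseteq> {0..}" and r: "r \<in> T"
  shows "indep_set (sets (increment_algebra M N (T \<inter> {..r}))) (sets (increment_algebra M N (T \<inter> {r..})))"
proof -
  define xs where "xs = sorted_list_of_set T"
  have xs: "sorted xs" "distinct xs" "set xs = T" using T by (auto simp: xs_def)
  define n where "n = length xs - 1"
  have len: "length xs = Suc n" using r xs by (cases xs) (auto simp: n_def)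
  define t where "t = (\<lambda>i. xs ! i)"
  have less: "t i < t j" if "i < j" "j \<le> n" for i j
    using xs that len sorted_wrt_nth_less[of "(<)" xs i j] by (simp add: t_def strict_sorted_iff)
  have in_T: "x \<in> T \<longleftrightarrow> (\<exists>i\<le>n. t i = x)" for x
    using len xs(3) by (auto simp: t_def in_set_conv_nth less_Suc_eq_le)
  obtain m where m: "m \<le> n" "t m = r" using in_T r by auto
  have t0: "0 \<le> t i" if "i \<le> n" for i using in_T T that by force
  define X where "X = (\<lambda>i \<omega>. N (t (Suc i)) \<omega> - N (t i) \<omega>)"
  define E where "E = (\<lambda>i. {X i -` A \<inter> space M | A. A \<in> sets (count_space (UNIV :: nat set))})"
  have "indep_vars (\<lambda>_. count_space UNIV) X {..<n}"
    unfolding X_def by (rule N_indep_increments) (use less t0 in auto)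
  hence indep: "indep_sets E {..<n}" by (simp add: indep_vars_def2 E_def)
  \<comment> \<open>As \<open>X i\<close> runs from \<open>t i\<close> to \<open>t (Suc i)\<close>
    and \<open>t m = r\<close>, the indices below \<open>m\<close> belong to the past and the others
    to the future.\<close>
  define I where "I = case_bool {..<m} {m..<n}"
  have I_un: "(\<Union>j\<in>UNIV. I j) = {..<n}" using m by (auto simp: I_def UNIV_bool)
  have "indep_sets (\<lambda>j. sigma_sets (space M) (\<Union>i\<in>I j. E i)) UNIV"
  proof (rule indep_sets_collect_sigma)
    show "indep_sets E (\<Union>j\<in>UNIV. I j)" using indep I_un by simp
    show "disjoint_family_on I UNIV"
      by (auto simp: disjoint_family_on_def I_def split: bool.splits)
    fix i show "Int_stable (E i)" unfolding E_def Int_stable_def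
      by (auto simp: vimage_Int[symmetric]) (metis Int_assoc Int_commute Int_left_absorb vimage_Int)
  qed
  \<comment> \<open>Telescoping by induction on \<open>j\<close>; monotone paths make the
    differences of natural numbers add up.\<close>
  moreover have inc: "(\<lambda>\<omega>. N (t j) \<omega> - N (t i) \<omega>) \<in> measurable (sigma (space M) (\<Union>l\<in>L. E l)) (count_space UNIV)"
    if "i \<le> j" "j \<le> n" "{i..<j} \<subseteq> L" for i j L
    using that
  proof (induction j rule: dec_induct)
    case base
    show ?case by simp
  next
    case (step j)
    let ?S = "sigma (space M) (\<Union>l\<in>L. E l)"
    have sp: "space ?S = space M" by (simp add: space_measure_of_conv)
    have E_sub: "(\<Union>l\<in>L. E l) \<subseteq> Pow (space M)" by (auto simp: E_def)
    have [measurable]: "X j \<in> measurable ?S (count_space UNIV)"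
    proof (rule measurableI)
      fix A :: "nat set"
      have "X j -` A \<inter> space M \<in> (\<Union>l\<in>L. E l)" using step
        by (intro UN_I[of j]) (auto simp: E_def)
      thus "X j -` A \<inter> space ?S \<in> sets ?S" unfolding sp sets_measure_of[OF E_sub] by (rule sigma_sets.Basic)
    qed simp
    have IH: "(\<lambda>\<omega>. N (t j) \<omega> - N (t i) \<omega>) \<in> measurable ?S (count_space UNIV)"
    proof (rule step.IH)
      show "{i..<j} \<subseteq> L" using step.prems(2) by (rule order_trans[rotated]) auto
    qed (use step.prems in auto)
    have "(\<lambda>\<omega>. (N (t j) \<omega> - N (t i) \<omega>) + X j \<omega>) \<in> measurable ?S (count_space UNIV)"
      using IH by measurable
    also have "?this \<longleftrightarrow> ?case"
    proof (rule measurable_cong)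
      fix \<omega> assume "\<omega> \<in> space ?S"
      hence \<omega>: "\<omega> \<in> space M" by (simp add: sp)
      have "N (t i) \<omega> \<le> N (t j) \<omega>"
        by (cases "i = j") (use \<omega> step less[of i j] t0[of i] in \<open>auto intro!: N_mono\<close>)
      moreover have "N (t j) \<omega> \<le> N (t (Suc j)) \<omega>"
        using \<omega> step less[of j "Suc j"] t0[of j] by (auto intro!: N_mono)
      ultimately show "N (t j) \<omega> - N (t i) \<omega> + X j \<omega> = N (t (Suc j)) \<omega> - N (t i) \<omega>"
        by (simp add: X_def)
    qed
    finally show ?case .
  qed
  ultimately show ?thesis
    unfolding indep_set_def
  proof (elim indep_sets_mono_sets)
    fix b :: bool
    have E_sub: "(\<Union>l\<in>I b. E l) \<subseteq> Pow (space M)" by (auto simp: E_def)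
    have mono: "i \<le> j" if "t i \<le> t j" "i \<le> n" for i j
      using less[of j i] that by (cases "i \<le> j") auto
    have "sets (increment_algebra M N (T \<inter> (if b then {..r} else {r..}))) \<subseteq> sets (sigma (space M) (\<Union>l\<in>I b. E l))"
    proof (rule sets_increment_algebra_le)
      fix q u assume qu: "q \<in> T \<inter> (if b then {..r} else {r..})" "u \<in> T \<inter> (if b then {..r} else {r..})" "q \<le> u"
      then obtain i j where ij: "i \<le> n" "q = t i" "j \<le> n" "u = t j" using in_T by auto
      have "i \<le> j" using mono[of i j] qu ij by simp
      moreover have "{i..<j} \<subseteq> I b"
        using qu ij m mono[of j m] mono[of m i] by (auto simp: I_def split: if_splits)
      ultimately show "(\<lambda>\<omega>. N u \<omega> - N q \<omega>) \<in> measurable (sigma (space M) (\<Union>l\<in>I b. E l)) (count_space UNIV)"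
        unfolding ij using inc ij by blast
    qed (simp add: space_measure_of_conv)
    thus "(case b of True \<Rightarrow> sets (increment_algebra M N (T \<inter> {..r})) | False \<Rightarrow> sets (increment_algebra M N (T \<inter> {r..})))
       \<subseteq> sigma_sets (space M) (\<Union>l\<in>I b. E l)"
      unfolding sets_measure_of[OF E_sub] by (cases b) simp_all
  qed
qed

text \<open>An increment involves only two times, so finite sets of times generate both
  sigma-algebras. Their unions are pi-systems, on which the finite case applies.\<close>

lemma indep_increments_past_future:
  assumes r: "0 \<le> r"
  shows "indep_set (sets (increment_algebra M N {0..r})) (sets (increment_algebra M N {r..}))"
proof -
  define U where "U S = (\<Union>T\<in>{T. finite T \<and> T \<subseteq> S}. sets (increment_algebra M N T))" for S
  have U: "sets (increment_algebra M N S) = sigma_sets (space M) (U S)" "Int_stable (U S)" if "S \<subseteq> {0..}" for S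
  proof -
    show "Int_stable (U S)" unfolding U_def
    proof (rule Int_stable_directed_UN)
      fix T T' assume "T \<in> {T. finite T \<and> T \<subseteq> S}" "T' \<in> {T. finite T \<and> T \<subseteq> S}"
      thus "\<exists>K\<in>{T. finite T \<and> T \<subseteq> S}. sets (increment_algebra M N T) \<subseteq> sets (increment_algebra M N K) \<and>
          sets (increment_algebra M N T') \<subseteq> sets (increment_algebra M N K)"
        by (intro bexI[of _ "T \<union> T'"] conjI sets_increment_algebra_mono) auto
    qed
    have "sigma_sets (space M) (U S) \<subseteq> sets (increment_algebra M N S)"
      using sets.sigma_sets_subset[of "U S" "increment_algebra M N S"] sets_increment_algebra_mono[of _ S M N]
      unfolding U_def by auto
    moreover have "sets (increment_algebra M N S) \<subseteq> sigma_sets (space M) (U S)"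
      unfolding sets_increment_algebra[of M N S]
    proof (rule sigma_sets_mono)
      show "{(\<lambda>\<omega>. N u \<omega> - N q \<omega>) -` A \<inter> space M |q u A. q \<in> S \<and> u \<in> S \<and> q \<le> u} \<subseteq> sigma_sets (space M) (U S)"
      proof safe
        fix q u and A :: "nat set" assume "q \<in> S" "u \<in> S" "q \<le> u"
        hence "(\<lambda>\<omega>. N u \<omega> - N q \<omega>) -` A \<inter> space M \<in> sets (increment_algebra M N {q, u})"
          using measurable_sets[OF measurable_increment_algebra[of q "{q,u}" u N M], of A] by simp
        hence "(\<lambda>\<omega>. N u \<omega> - N q \<omega>) -` A \<inter> space M \<in> U S"
          unfolding U_def using \<open>q \<in> S\<close> \<open>u \<in> S\<close> by (intro UN_I[of "{q, u}"]) auto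
        thus "(\<lambda>\<omega>. N u \<omega> - N q \<omega>) -` A \<inter> space M \<in> sigma_sets (space M) (U S)" by (rule sigma_sets.Basic)
      qed
    qed
    ultimately show "sets (increment_algebra M N S) = sigma_sets (space M) (U S)" by simp
  qed
  have U_ev: "U S \<subseteq> events" if "S \<subseteq> {0..}" for S
  proof -
    have "U S \<subseteq> sets (increment_algebra M N S)" unfolding U(1)[OF that] by (auto intro: sigma_sets.Basic)
    also have "\<dots> \<subseteq> events" using subalgebra_increment_algebra[OF that] by (simp add: subalgebra_def)
    finally show ?thesis .
  qed
  have "indep_set (U {0..r}) (U {r..})"
  proof (rule indep_setI)
    show "U {0..r} \<subseteq> events" "U {r..} \<subseteq> events"
      using r by (auto intro!: U_ev)
    fix a b assume "a \<in> U {0..r}" "b \<in> U {r..}"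
    then obtain T T' where T: "finite T" "T \<subseteq> {0..r}" "a \<in> sets (increment_algebra M N T)"
      and T': "finite T'" "T' \<subseteq> {r..}" "b \<in> sets (increment_algebra M N T')" unfolding U_def by auto
    \<comment> \<open>The finite case splits only at a member of the set of times, hence
      \<open>r\<close> is inserted.\<close>
    let ?T = "insert r (T \<union> T')"
    have "a \<in> sets (increment_algebra M N (?T \<inter> {..r}))"
      by (rule subsetD[OF sets_increment_algebra_mono T(3)]) (use T(2) in auto)
    moreover have "b \<in> sets (increment_algebra M N (?T \<inter> {r..}))"
      by (rule subsetD[OF sets_increment_algebra_mono T'(3)]) (use T'(2) in auto)
    moreover have "?T \<subseteq> {0..}" using T T' r by auto
    ultimately show "prob (a \<inter> b) = prob a * prob b"
      using indep_increments_finite[of ?T r] T(1) T'(1) by (intro indep_setD) auto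
  qed
  thus ?thesis using U[of "{0..r}"] U[of "{r..}"] r
    by (auto intro!: indep_set_sigma_sets)
qed

section \<open>The observation filtration and the increments after it\<close>

lemma natural_generators_sub: "natural_generators M N T \<subseteq> Pow (space M)"
  by (auto simp: natural_generators_def)

text \<open>Since \<open>N 0\<close> vanishes, each value \<open>N s\<close> is itself an increment
  from time 0.\<close>

lemma natural_generators_increments:
  assumes "0 \<le> r"
  shows "sigma_sets (space M) (natural_generators M N {0..r}) \<subseteq> sets (increment_algebra M N {0..r})"
proof -
  have "natural_generators M N {0..r} \<subseteq> sets (increment_algebra M N {0..r})"
    unfolding natural_generators_def
  proof safe
    fix s and A :: "nat set" assume s: "s \<in> {0..r}"
    have "N s -` A \<inter> space M = (\<lambda>\<omega>. N s \<omega> - N 0 \<omega>) -` A \<inter> space M" using N_zero by auto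
    thus "N s -` A \<inter> space M \<in> sets (increment_algebra M N {0..r})"
      using measurable_sets[OF measurable_increment_algebra[of 0 "{0..r}" s N M], of A] s assms by simp
  qed
  thus ?thesis using sets.sigma_sets_subset[of _ "increment_algebra M N {0..r}"] by simp
qed

lemma space_obs_filtration [simp]: "space (obs_filtration M N t) = space M"
  by (simp add: obs_filtration_def space_measure_of_conv)

text \<open>An intersection of sigma-algebras is a sigma-algebra and hence equals what it
  generates.\<close>

lemma sets_obs_filtration:
  "sets (obs_filtration M N t) = (\<Inter>u\<in>{t<..}. sigma_sets (space M) (natural_generators M N {0..u} \<union> null_sets M))"
proof -
  let ?G = "\<lambda>u. natural_generators M N {0..u} \<union> null_sets M"
  have G: "?G u \<subseteq> Pow (space M)" for u using natural_generators_sub null_setsD2 sets.sets_into_space by blast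
  have *: "(\<Inter>u\<in>{t<..}. sigma_sets (space M) (?G u)) \<subseteq> Pow (space M)"
    using sigma_sets_into_sp[OF G[of "t + 1"]] by (intro INF_lower2[of "t + 1"]) auto
  have "sigma_sets (space M) (\<Inter>u\<in>{t<..}. sigma_sets (space M) (?G u)) \<subseteq> sigma_sets (space M) (?G u)" if "t < u" for u
    by (rule sigma_sets_mono) (use that in auto)
  thus ?thesis unfolding obs_filtration_def sets_measure_of[OF *] by (auto intro: sigma_sets.Basic)
qed

lemma subalgebra_obs_filtration: "subalgebra M (obs_filtration M N t)"
proof -
  have "natural_generators M N {0..u} \<subseteq> events" for u
    using N_measurable by (auto simp: natural_generators_def intro!: measurable_sets)
  hence "sigma_sets (space M) (natural_generators M N {0..u} \<union> null_sets M) \<subseteq> events" for u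
    by (intro sets.sigma_sets_subset) auto
  hence "(\<Inter>u\<in>{t<..}. sigma_sets (space M) (natural_generators M N {0..u} \<union> null_sets M)) \<subseteq> events"
    by (intro INF_lower2[of "t + 1"]) auto
  thus ?thesis unfolding subalgebra_def sets_obs_filtration by simp
qed

lemma null_sets_obs_filtration: "null_sets M \<subseteq> sets (obs_filtration M N t)"
  unfolding sets_obs_filtration by (auto intro: sigma_sets.Basic)

lemma measurable_obs_filtration:
  assumes "0 \<le> s" "s \<le> t"
  shows "N s \<in> measurable (obs_filtration M N t) (count_space UNIV)"
proof (rule measurableI)
  fix A :: "nat set"
  have "N s -` A \<inter> space M \<in> natural_generators M N {0..u}" if "t < u" for u
    using that assms unfolding natural_generators_def by (intro CollectI exI[of _ s] exI[of _ A]) auto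
  thus "N s -` A \<inter> space (obs_filtration M N t) \<in> sets (obs_filtration M N t)"
    unfolding sets_obs_filtration by (auto intro: sigma_sets.Basic)
qed simp

text \<open>An event of \<open>F\<^sub>s\<close> is a priori independent only of the increments after each \<open>r > s\<close>; these
  generate \<open>\<sigma>\<close>-algebras that increase as \<open>r\<close> decreases to \<open>s\<close>, so their union is a \<open>\<pi>\<close>-system.\<close>

lemma indep_obs_filtration_increments:
  assumes s: "0 \<le> s"
  shows "indep_set (sets (obs_filtration M N s)) (sets (increment_algebra M N {s<..}))"
proof -
  define B where "B = (\<Union>r\<in>{s<..}. sets (increment_algebra M N {r..}))"
  have "indep_set (sets (obs_filtration M N s)) B"
  proof (rule indep_setI)
    show "sets (obs_filtration M N s) \<subseteq> events" using subalgebra_obs_filtration by (simp add: subalgebra_def)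
    show "B \<subseteq> events" unfolding B_def
    proof (rule UN_least)
      fix r assume "r \<in> {s<..}"
      hence "subalgebra M (increment_algebra M N {r..})"
        using s by (intro subalgebra_increment_algebra) auto
      thus "sets (increment_algebra M N {r..}) \<subseteq> events" by (simp add: subalgebra_def)
    qed
    fix a b assume a: "a \<in> sets (obs_filtration M N s)" and "b \<in> B"
    then obtain r where r: "s < r" "b \<in> sets (increment_algebra M N {r..})" by (auto simp: B_def)
    \<comment> \<open>As \<open>s < r\<close>, the event \<open>a\<close> lies in the past up to
      \<open>r\<close> enlarged by null sets, which is independent of the increments after
      \<open>r\<close>.\<close>
    have "indep_set (sigma_sets (space M) (natural_generators M N {0..r})) (sets (increment_algebra M N {r..}))"
      using indep_increments_past_future[of r] natural_generators_increments[of r] s r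
      unfolding indep_sets2_eq by auto
    from indep_set_null_sets[OF natural_generators_sub this]
    show "prob (a \<inter> b) = prob a * prob b"
      using a r by (intro indep_setD) (auto simp: sets_obs_filtration)
  qed
  moreover have "Int_stable (sets (obs_filtration M N s))" by (auto simp: Int_stable_def)
  moreover have "Int_stable B" unfolding B_def
  proof (rule Int_stable_directed_UN)
    fix i j assume "i \<in> {s<..}" "j \<in> {s<..}"
    thus "\<exists>k\<in>{s<..}. sets (increment_algebra M N {i..}) \<subseteq> sets (increment_algebra M N {k..}) \<and>
            sets (increment_algebra M N {j..}) \<subseteq> sets (increment_algebra M N {k..})"
      by (intro bexI[of _ "min i j"] conjI sets_increment_algebra_mono) auto
  qed
  ultimately have indep: "indep_set (sigma_sets (space M) (sets (obs_filtration M N s))) (sigma_sets (space M) B)"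
    by (rule indep_set_sigma_sets)
  have "sigma_sets (space M) (sets (obs_filtration M N s)) = sets (obs_filtration M N s)"
    using sets.sigma_sets_eq[of "obs_filtration M N s"] by simp
  moreover have "sets (increment_algebra M N {s<..}) \<subseteq> sigma_sets (space M) B"
    unfolding sets_increment_algebra[of M N "{s<..}"]
  proof (rule sigma_sets_mono')
    show "{(\<lambda>\<omega>. N u \<omega> - N q \<omega>) -` A \<inter> space M |q u A. q \<in> {s<..} \<and> u \<in> {s<..} \<and> q \<le> u} \<subseteq> B"
    proof safe
      fix q u and A :: "nat set" assume *: "s < q" "q \<le> u"
      hence "(\<lambda>\<omega>. N u \<omega> - N q \<omega>) -` A \<inter> space M \<in> sets (increment_algebra M N {q..})"
        using measurable_sets[OF measurable_increment_algebra[of q "{q..}" u N M], of A] by simp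
      thus "(\<lambda>\<omega>. N u \<omega> - N q \<omega>) -` A \<inter> space M \<in> B" using * by (auto simp: B_def)
    qed
  qed
  ultimately show ?thesis using indep unfolding indep_sets2_eq by auto
qed

text \<open>The critical case is \<open>q = s\<close>: such an increment is not among the
  generators, but by right continuity it is a limit of increments starting later.\<close>

lemma borel_measurable_increment_right:
  assumes s: "0 \<le> s" "s \<le> q" "q \<le> u"
  shows "(\<lambda>\<omega>. real (N u \<omega>) - real (N q \<omega>)) \<in> borel_measurable (increment_algebra M N {s<..})"
proof -
  have *: "(\<lambda>\<omega>. real (N u \<omega>) - real (N q \<omega>)) \<in> borel_measurable (increment_algebra M N {s<..})"
    if "s < q" "q \<le> u" for q
  proof -
    have "(\<lambda>\<omega>. N u \<omega> - N q \<omega>) \<in> measurable (increment_algebra M N {s<..}) (count_space UNIV)"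
      using that by (intro measurable_increment_algebra) auto
    hence "(\<lambda>\<omega>. real (N u \<omega> - N q \<omega>)) \<in> borel_measurable (increment_algebra M N {s<..})" by measurable
    also have "?this \<longleftrightarrow> ?thesis"
      by (rule measurable_cong) (use N_mono that s in \<open>auto simp: of_nat_diff\<close>)
    finally show ?thesis .
  qed
  consider "q = u" | "s < q" | "q = s" "s < u" using s by linarith
  thus ?thesis
  proof cases
    case 3
    define p where "p n = s + (u - s) / real (Suc n)" for n
    have p: "s < p n" "p n \<le> u" for n
    proof -
      show "s < p n" using 3 by (simp add: p_def)
      have "(u - s) / real (Suc n) \<le> (u - s) / 1" using 3 by (intro divide_left_mono) auto
      thus "p n \<le> u" by (simp add: p_def)
    qed
    have "(\<lambda>n. (u - s) / real (Suc n)) \<longlonglongrightarrow> 0"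
      using tendsto_mult[OF tendsto_const[of "u - s"] LIMSEQ_inverse_real_of_nat] by (simp add: divide_inverse)
    hence "p \<longlonglongrightarrow> s" unfolding p_def using tendsto_add[OF tendsto_const[of s]] by fastforce
    hence p_lim: "filterlim p (at_right s) sequentially"
      unfolding filterlim_at using p by (auto intro: always_eventually)
    show ?thesis unfolding 3(1)
    proof (rule borel_measurable_LIMSEQ_real)
      show "(\<lambda>\<omega>. real (N u \<omega>) - real (N (p n) \<omega>)) \<in> borel_measurable (increment_algebra M N {s<..})" for n
        by (rule *) (use p in auto)
      fix \<omega> assume "\<omega> \<in> space (increment_algebra M N {s<..})"
      hence "((\<lambda>r. real (N r \<omega>)) \<longlongrightarrow> real (N s \<omega>)) (at_right s)"
        using N_right_continuous[of \<omega> s] s by (simp add: continuous_within)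
      hence "(\<lambda>n. real (N (p n) \<omega>)) \<longlonglongrightarrow> real (N s \<omega>)" using p_lim by (rule filterlim_compose)
      thus "(\<lambda>n. real (N u \<omega>) - real (N (p n) \<omega>)) \<longlonglongrightarrow> real (N u \<omega>) - real (N s \<omega>)"
        by (intro tendsto_intros)
    qed
  qed (use * s in auto)
qed

end

section \<open>The likelihood process\<close>

context poisson_process
begin

text \<open>The likelihood ratio on \<open>(r, t]\<close> of rate \<open>v\<close> against rate \<open>\<mu>\<close>. For \<open>v \<le> 0\<close> this has no such
  meaning, but it still agrees with \<^const>\<open>likelihood\<close>, where the same junk values of \<open>ln\<close> occur.\<close>

definition likelihood_ratio :: "real \<Rightarrow> real \<Rightarrow> real \<Rightarrow> 'a \<Rightarrow> real" where
  "likelihood_ratio v r t \<omega> = exp (ln (v / \<mu>) * (real (N t \<omega>) - real (N r \<omega>)) - (v - \<mu>) * (t - r))"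

lemma likelihood_ratio_pos: "0 < likelihood_ratio v r t \<omega>" and likelihood_ratio_self: "likelihood_ratio v t t \<omega> = 1"
  by (simp_all add: likelihood_ratio_def)

text \<open>The exponents add. This cocycle identity lets the likelihood be split at an intermediate
  time.\<close>

lemma likelihood_ratio_mult: "likelihood_ratio v s t \<omega> * likelihood_ratio v r s \<omega> = likelihood_ratio v r t \<omega>"
  by (simp add: likelihood_ratio_def exp_add[symmetric] algebra_simps)

text \<open>The bound is free of \<open>r\<close>, so it remains valid for a random start
  time.\<close>

lemma likelihood_ratio_le:
  assumes "\<omega> \<in> space M" "0 \<le> r" "r \<le> t"
  shows "likelihood_ratio v r t \<omega> \<le> exp (\<bar>ln (v / \<mu>)\<bar> * real (N t \<omega>) + \<bar>v - \<mu>\<bar> * t)"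
proof -
  have "N r \<omega> \<le> N t \<omega>" using assms by (intro N_mono) auto
  hence "ln (v / \<mu>) * (real (N t \<omega>) - real (N r \<omega>)) \<le> \<bar>ln (v / \<mu>)\<bar> * real (N t \<omega>)"
    by (intro mult_mono) auto
  moreover have "(\<mu> - v) * (t - r) \<le> \<bar>v - \<mu>\<bar> * t"
    using assms by (intro mult_mono) auto
  ultimately show ?thesis unfolding likelihood_ratio_def by (simp add: algebra_simps)
qed

text \<open>Against the Poisson weights this is the exponential series at
  \<open>\<mu> * t * exp c\<close>. Time 0 is separate because the Poisson law is given for
  intervals of positive length.\<close>

lemma integrable_exp_N:
  assumes "0 \<le> t"
  shows "integrable M (\<lambda>\<omega>. exp (c * real (N t \<omega>)))"
proof (cases "t = 0")
  case True
  have "integrable M (\<lambda>\<omega>. exp (c * real (N t \<omega>))) \<longleftrightarrow> integrable M (\<lambda>\<omega>. 1 :: real)"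
    by (rule Bochner_Integration.integrable_cong) (auto simp: True N_zero)
  thus ?thesis by simp
next
  case False
  hence t: "0 < t" using assms by simp
  \<comment> \<open>The form \<open>t - 0\<close> is kept to match \<open>N_increment_distr\<close>
    at \<open>s = 0\<close>.\<close>
  have m: "0 < \<mu> * (t - 0)" using t rate_pos by simp
  have [measurable]: "N t \<in> measurable M (count_space UNIV)" "N 0 \<in> measurable M (count_space UNIV)"
    using N_measurable t by auto
  let ?p = "poisson_pmf (\<mu> * (t - 0))"
  have "summable (\<lambda>n. exp (- (\<mu> * t)) * ((\<mu> * t * exp c) ^ n /\<^sub>R fact n))"
    by (intro summable_mult summable_exp_generic)
  also have "(\<lambda>n. exp (- (\<mu> * t)) * ((\<mu> * t * exp c) ^ n /\<^sub>R fact n)) = (\<lambda>n. norm (pmf ?p n *\<^sub>R exp (c * real n)))"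
    using m t rate_pos
    by (auto simp: fun_eq_iff power_mult_distrib exp_of_nat_mult[symmetric] mult.commute divide_inverse abs_mult power_abs)
  finally have "integrable (count_space UNIV) (\<lambda>n. pmf ?p n *\<^sub>R exp (c * real n))"
    by (simp add: integrable_count_space_nat_iff)
  hence "integrable (measure_pmf ?p) (\<lambda>n. exp (c * real n))"
    unfolding measure_pmf_eq_density by (subst integrable_density) auto
  hence "integrable (distr M (count_space UNIV) (\<lambda>\<omega>. N t \<omega> - N 0 \<omega>)) (\<lambda>n. exp (c * real n))"
    using N_increment_distr[of 0 t] t by simp
  hence "integrable M (\<lambda>\<omega>. exp (c * real (N t \<omega> - N 0 \<omega>)))"
    by (rule integrable_distr[rotated]) measurable
  also have "?this \<longleftrightarrow> ?thesis"
    by (rule Bochner_Integration.integrable_cong) (auto simp: N_zero)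
  finally show ?thesis .
qed

lemma integral_interval_measure_path:
  assumes \<omega>: "\<omega> \<in> space M" and "0 \<le> a" "a \<le> t"
  shows "(LINT s:{a<..t}|interval_measure (\<lambda>s. real (N (max 0 s) \<omega>)). c) = c * (real (N t \<omega>) - real (N a \<omega>))"
proof -
  let ?F = "\<lambda>s. real (N (max 0 s) \<omega>)"
  have "emeasure (interval_measure ?F) {a<..t} = ?F t - ?F a"
  proof (rule emeasure_interval_measure_Ioc)
    show "?F x \<le> ?F y" if "x \<le> y" for x y
      using N_mono[OF \<omega>, of "max 0 x" "max 0 y"] that by auto
    \<comment> \<open>The Stieltjes measure needs right continuity on the whole line: the extended
      path is constant below 0 and follows \<open>N\<close> from 0 on.\<close>
    show "continuous (at_right x) ?F" for x
    proof (cases "x < 0")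
      case True
      have "eventually (\<lambda>s. ?F s = ?F x) (at_right x)"
        by (rule eventually_at_rightI[of x 0]) (use True in \<open>auto simp: max_def\<close>)
      thus ?thesis by (simp add: continuous_within tendsto_eventually)
    next
      case False
      hence x: "0 \<le> x" by simp
      have "eventually (\<lambda>s. real (N s \<omega>) = ?F s) (at_right x)"
        by (rule eventually_at_rightI[of x "x + 1"]) (use x in \<open>auto simp: max_def\<close>)
      moreover have "((\<lambda>s. real (N s \<omega>)) \<longlongrightarrow> ?F x) (at_right x)"
        using N_right_continuous[OF \<omega> x] x by (simp add: continuous_within)
      ultimately show ?thesis unfolding continuous_within by (rule Lim_transform_eventually[rotated])
    qed
  qed fact
  moreover have "N a \<omega> \<le> N t \<omega>" using assms by (intro N_mono) auto
  ultimately have "measure (interval_measure ?F) {a<..t} = real (N t \<omega>) - real (N a \<omega>)"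
    and "emeasure (interval_measure ?F) {a<..t} < \<infinity>"
    using assms by (simp_all add: measure_def max_def)
  thus ?thesis by (simp add: set_lebesgue_integral_def)
qed

end

text \<open>Up to \<open>\<theta>\<close> the logarithm is \<open>ln 1\<close>, afterwards it is
  constant. If \<open>\<theta>\<close> exceeds \<open>t\<close>, the minimum makes the interval
  empty and both sides are 1.\<close>

lemma (in poisson_disorder) likelihood_eq_likelihood_ratio:
  assumes \<omega>: "\<omega> \<in> space M" and t: "0 \<le> t" and \<theta>: "0 \<le> \<theta> \<omega>"
  shows "likelihood N \<mu> \<theta> \<Lambda> t \<omega> = likelihood_ratio (\<Lambda> \<omega>) (min (\<theta> \<omega>) t) t \<omega>"
proof -
  let ?F = "interval_measure (\<lambda>s. real (N (max 0 s) \<omega>))" and ?a = "min (\<theta> \<omega>) t"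
  let ?c = "ln (\<Lambda> \<omega> / \<mu>)"
  have lim: "Lim (at_left s) (\<lambda>r. rate \<mu> \<theta> \<Lambda> r \<omega>) = (if s \<le> \<theta> \<omega> then \<mu> else \<Lambda> \<omega>)" for s
  proof (rule tendsto_Lim)
    \<comment> \<open>At \<open>s = \<theta>\<close> the left limit is still \<open>\<mu>\<close>,
      so a jump exactly at \<open>\<theta>\<close> is not weighted; hence the interval open on the
      left below.\<close>
    have "eventually (\<lambda>r. rate \<mu> \<theta> \<Lambda> r \<omega> = (if s \<le> \<theta> \<omega> then \<mu> else \<Lambda> \<omega>)) (at_left s)"
      by (rule eventually_at_leftI[of "if s \<le> \<theta> \<omega> then s - 1 else \<theta> \<omega>"]) (auto simp: rate_def split: if_splits)
    thus "((\<lambda>r. rate \<mu> \<theta> \<Lambda> r \<omega>) \<longlongrightarrow> (if s \<le> \<theta> \<omega> then \<mu> else \<Lambda> \<omega>)) (at_left s)"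
      by (rule tendsto_eventually)
  qed simp
  have "(LINT s:{0<..t}|?F. ln (Lim (at_left s) (\<lambda>r. rate \<mu> \<theta> \<Lambda> r \<omega>) / \<mu>)) = (LINT s:{?a<..t}|?F. ?c)"
    unfolding set_lebesgue_integral_def lim
    by (rule Bochner_Integration.integral_cong) (use \<theta> rate_pos in \<open>auto simp: indicator_def min_def\<close>)
  also have "\<dots> = ?c * (real (N t \<omega>) - real (N ?a \<omega>))"
    by (rule integral_interval_measure_path[OF \<omega>]) (use \<theta> t in auto)
  finally have stieltjes: "(LINT s:{0<..t}|?F. ln (Lim (at_left s) (\<lambda>r. rate \<mu> \<theta> \<Lambda> r \<omega>) / \<mu>)) = ?c * (real (N t \<omega>) - real (N ?a \<omega>))" .
  have "(LINT s:{0..t}|lborel. rate \<mu> \<theta> \<Lambda> s \<omega> - \<mu>) = (LINT s:{\<theta> \<omega>..t}|lborel. \<Lambda> \<omega> - \<mu>)"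
    unfolding set_lebesgue_integral_def
    by (rule Bochner_Integration.integral_cong) (use \<theta> in \<open>auto simp: indicator_def rate_def\<close>)
  also have "\<dots> = (\<Lambda> \<omega> - \<mu>) * (t - ?a)"
    by (cases "\<theta> \<omega> \<le> t") (auto simp: set_lebesgue_integral_def)
  finally show ?thesis unfolding likelihood_def likelihood_ratio_def stieltjes by simp
qed

section \<open>Averaging over the change time and the new rate\<close>

context poisson_disorder
begin

definition disorder_algebra :: "'a measure" where
  "disorder_algebra = sigma (space M) (rv_sets M \<theta> \<union> rv_sets M \<Lambda>)"

lemma rv_sets_Pow: "rv_sets M X \<subseteq> Pow (space M)"
  using sets.sets_into_space[of _ "vimage_algebra (space M) X borel"] by (auto simp: rv_sets_def)

lemma rv_sets_eq: "rv_sets M X = {X -` A \<inter> space M | A. A \<in> sets borel}"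
  unfolding rv_sets_def by (rule sets_vimage_algebra2) simp

lemma rv_sets_events: "X \<in> borel_measurable M \<Longrightarrow> rv_sets M X \<subseteq> events"
  by (auto simp: rv_sets_eq intro: measurable_sets)

lemma borel_measurable_if_rv_sets:
  assumes "rv_sets M X \<subseteq> sets K" "space K = space M"
  shows "X \<in> borel_measurable K"
proof (rule measurableI)
  fix A :: "real set" assume "A \<in> sets borel"
  hence "X -` A \<inter> space M \<in> rv_sets M X" unfolding rv_sets_eq by blast
  thus "X -` A \<inter> space K \<in> sets K" using assms by auto
qed simp

lemma space_disorder_algebra [simp]: "space disorder_algebra = space M"
  by (simp add: disorder_algebra_def space_measure_of_conv)

lemma sets_disorder_algebra: "sets disorder_algebra = sigma_sets (space M) (rv_sets M \<theta> \<union> rv_sets M \<Lambda>)"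
  unfolding disorder_algebra_def by (rule sets_measure_of) (use rv_sets_Pow in auto)

lemma subalgebra_disorder_algebra: "subalgebra M disorder_algebra"
  unfolding subalgebra_def sets_disorder_algebra
  using rv_sets_events[OF theta_rv] rv_sets_events[OF Lambda_rv] by (auto intro!: sets.sigma_sets_subset)

lemma measurable_disorder_algebra [measurable]:
  "\<theta> \<in> borel_measurable disorder_algebra" "\<Lambda> \<in> borel_measurable disorder_algebra"
  by (auto intro!: borel_measurable_if_rv_sets intro: sigma_sets.Basic simp: sets_disorder_algebra)

text \<open>The three independent sigma-algebras are regrouped as the path of \<open>N\<close>
  against \<open>\<theta>\<close> and \<open>\<Lambda>\<close> together; null sets are then adjoined
  on the side of the path.\<close>

lemma indep_obs_filtration_disorder:
  "indep_set (sets (obs_filtration M N t)) (sets disorder_algebra)"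
proof -
  define G where "G = natural_generators M N {0..}"
  define E where "E = (!) [sigma_sets (space M) G, rv_sets M \<theta>, rv_sets M \<Lambda>]"
  have G: "G \<subseteq> Pow (space M)" by (auto simp: G_def natural_generators_def)
  have "indep_sets (\<lambda>j. sigma_sets (space M) (\<Union>i\<in>case_bool {0} {1, 2} j. E i)) UNIV"
  proof (rule indep_sets_collect_sigma)
    have "(\<Union>j. case_bool {0} {1, 2} j) = {..<3::nat}" by (auto simp: UNIV_bool)
    thus "indep_sets E (\<Union>j. case_bool {0} {1, 2} j)" using independent by (simp add: E_def G_def)
    show "disjoint_family_on (case_bool {0} {1, 2::nat}) UNIV"
      by (auto simp: disjoint_family_on_def split: bool.splits)
    fix j :: bool and i :: nat assume "i \<in> (case j of True \<Rightarrow> {0} | False \<Rightarrow> {1, 2})"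
    hence "i = 0 \<or> i = 1 \<or> i = 2" by (auto split: bool.splits)
    moreover have "Int_stable (sigma_sets (space M) G)"
      using sets.Int_stable[of "sigma (space M) G"] G by simp
    ultimately show "Int_stable (E i)"
      using sets.Int_stable[of "vimage_algebra (space M) \<theta> borel"] sets.Int_stable[of "vimage_algebra (space M) \<Lambda> borel"]
      by (auto simp: E_def rv_sets_def)
  qed
  hence "indep_set (sigma_sets (space M) G) (sets disorder_algebra)"
    unfolding indep_set_def
    by (rule indep_sets_mono_sets) (auto simp: E_def sets_disorder_algebra sigma_sets.Basic split: bool.splits)
  hence indep: "indep_set (sigma_sets (space M) (G \<union> null_sets M)) (sets disorder_algebra)"
    by (rule indep_set_null_sets[OF G])
  \<comment> \<open>The right-continuous enlargement at \<open>t\<close> is contained in the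
    enlarged past up to \<open>t + 1\<close>, hence in that of the whole path.\<close>
  have "sigma_sets (space M) (natural_generators M N {0..t + 1} \<union> null_sets M) \<subseteq> sigma_sets (space M) (G \<union> null_sets M)"
    by (rule sigma_sets_mono') (auto simp: G_def natural_generators_def)
  hence "sets (obs_filtration M N t) \<subseteq> sigma_sets (space M) (G \<union> null_sets M)"
    unfolding sets_obs_filtration by (intro INF_lower2[of "t + 1"]) auto
  thus ?thesis using indep unfolding indep_sets2_eq by auto
qed

text \<open>The path of \<open>N\<close> is read off \<open>\<omega>\<close>, while \<open>\<theta>\<close> and \<open>\<Lambda>\<close> are read off an independent copy \<open>\<omega>'\<close>.\<close>

definition change_kernel :: "real set \<Rightarrow> real \<Rightarrow> real \<Rightarrow> 'a \<Rightarrow> 'a \<Rightarrow> real" where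
  "change_kernel B v t \<omega> \<omega>' = (if \<Lambda> \<omega>' = v \<and> \<theta> \<omega>' \<in> B then likelihood_ratio v (\<theta> \<omega>') t \<omega> else 0)"

text \<open>For \<open>B = {0..t}\<close> this is \<open>W\<^sup>v\<^sub>t\<close> of the overview;
  \<open>B = {s<..t}\<close> isolates changes after \<open>s\<close>.\<close>

definition change_weight :: "real set \<Rightarrow> real \<Rightarrow> real \<Rightarrow> 'a \<Rightarrow> real" where
  "change_weight B v t \<omega> = (\<integral>\<omega>'. change_kernel B v t \<omega> \<omega>' \<partial>M)"

lemma change_kernel_nonneg: "0 \<le> change_kernel B v t \<omega> \<omega>'"
  by (simp add: change_kernel_def likelihood_ratio_pos less_imp_le)

lemma change_weight_nonneg: "0 \<le> change_weight B v t \<omega>"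
  unfolding change_weight_def by (rule Bochner_Integration.integral_nonneg) (rule change_kernel_nonneg)

text \<open>The bound is free of \<open>\<omega>'\<close>, so it serves both for averaging over the
  copy and on the diagonal.\<close>

lemma change_kernel_le:
  assumes "\<omega> \<in> space M" "B \<subseteq> {0..t}"
  shows "change_kernel B v t \<omega> \<omega>' \<le> exp (\<bar>ln (v / \<mu>)\<bar> * real (N t \<omega>) + \<bar>v - \<mu>\<bar> * t)"
  using likelihood_ratio_le[OF assms(1), of "\<theta> \<omega>'" t v] assms(2) by (auto simp: change_kernel_def)

text \<open>Only increments ending at \<open>t\<close> enter, so \<open>F\<close> can be the
  observation filtration at \<open>t\<close> (with \<open>a = 0\<close>) or the increments after
  \<open>s\<close> (with \<open>a = s\<close>).\<close>

lemma borel_measurable_likelihood_ratio_pair: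
  assumes a: "0 \<le> a" "a \<le> t" and F: "space F = space M"
    and incr: "\<And>r. a \<le> r \<Longrightarrow> r \<le> t \<Longrightarrow> (\<lambda>\<omega>. real (N t \<omega>) - real (N r \<omega>)) \<in> borel_measurable F"
  shows "(\<lambda>(\<omega>, r). likelihood_ratio v (max a (min r t)) t \<omega>) \<in> borel_measurable (F \<Otimes>\<^sub>M borel)"
proof -
  have "(\<lambda>(\<omega>, r). real (N t \<omega>) - real (N (max a (min r t)) \<omega>)) \<in> borel_measurable (F \<Otimes>\<^sub>M borel)"
  proof (rule borel_measurable_right_continuous_pair[OF incr])
    fix r \<omega> assume "\<omega> \<in> space F" "a \<le> r"
    thus "continuous (at_right r) (\<lambda>s. real (N t \<omega>) - real (N s \<omega>))"
      using a F by (intro continuous_diff continuous_const N_right_continuous) auto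
  qed (use a in auto)
  from this[unfolded case_prod_beta, measurable] show ?thesis
    unfolding likelihood_ratio_def case_prod_beta by measurable
qed

lemma borel_measurable_change_kernel_pair:
  assumes a: "0 \<le> a" "a \<le> t" and F: "space F = space M"
    and incr: "\<And>r. a \<le> r \<Longrightarrow> r \<le> t \<Longrightarrow> (\<lambda>\<omega>. real (N t \<omega>) - real (N r \<omega>)) \<in> borel_measurable F"
    and B: "B \<in> sets borel" "B \<subseteq> {a..t}"
  shows "(\<lambda>(\<omega>, \<omega>'). change_kernel B v t \<omega> \<omega>') \<in> borel_measurable (F \<Otimes>\<^sub>M disorder_algebra)"
proof -
  have [measurable]: "(\<lambda>x. likelihood_ratio v (max a (min (\<theta> (snd x)) t)) t (fst x)) \<in> borel_measurable (F \<Otimes>\<^sub>M disorder_algebra)"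
    using measurable_compose[of "\<lambda>x. (fst x, \<theta> (snd x))" "F \<Otimes>\<^sub>M disorder_algebra" "F \<Otimes>\<^sub>M borel",
        OF _ borel_measurable_likelihood_ratio_pair[OF a F incr]] by simp
  \<comment> \<open>The clamping is invisible, because \<open>B\<close> lies in
    \<open>{a..t}\<close>.\<close>
  have "change_kernel B v t \<omega> \<omega>' = (if \<Lambda> \<omega>' = v \<and> \<theta> \<omega>' \<in> B then likelihood_ratio v (max a (min (\<theta> \<omega>') t)) t \<omega> else 0)" for \<omega> \<omega>'
    using B by (auto simp: change_kernel_def)
  thus ?thesis using B by (simp add: case_prod_beta)
qed

lemma borel_measurable_N_obs: "0 \<le> s \<Longrightarrow> s \<le> t \<Longrightarrow> (\<lambda>\<omega>. real (N s \<omega>)) \<in> borel_measurable (obs_filtration M N t)"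
  by (rule measurable_compose[OF measurable_obs_filtration]) auto

lemma borel_measurable_change_kernel_obs:
  assumes "0 \<le> t" "B \<in> sets borel" "B \<subseteq> {0..t}"
  shows "(\<lambda>(\<omega>, \<omega>'). change_kernel B v t \<omega> \<omega>') \<in> borel_measurable (obs_filtration M N t \<Otimes>\<^sub>M disorder_algebra)"
  by (rule borel_measurable_change_kernel_pair[of 0]) (use assms in \<open>auto intro!: borel_measurable_diff borel_measurable_N_obs\<close>)

lemma integrable_change_kernel:
  assumes "0 \<le> t" "B \<in> sets borel" "B \<subseteq> {0..t}" "\<omega> \<in> space M"
  shows "integrable M (change_kernel B v t \<omega>)"
proof (rule integrable_const_bound)
  have "change_kernel B v t \<omega> \<in> borel_measurable disorder_algebra"
    using measurable_Pair2[OF borel_measurable_change_kernel_obs[OF assms(1-3)], of \<omega>] assms(4) by simp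
  thus "change_kernel B v t \<omega> \<in> borel_measurable M"
    by (rule measurable_from_subalg[OF subalgebra_disorder_algebra])
  show "AE \<omega>' in M. norm (change_kernel B v t \<omega> \<omega>') \<le> exp (\<bar>ln (v / \<mu>)\<bar> * real (N t \<omega>) + \<bar>v - \<mu>\<bar> * t)"
    using change_kernel_le[OF assms(4,3)] change_kernel_nonneg by simp
qed

lemma integrable_change_kernel_diag:
  assumes "0 \<le> t" "B \<in> sets borel" "B \<subseteq> {0..t}"
  shows "integrable M (\<lambda>\<omega>. change_kernel B v t \<omega> \<omega>)"
proof (rule Bochner_Integration.integrable_bound)
  show "integrable M (\<lambda>\<omega>. exp (\<bar>v - \<mu>\<bar> * t) * exp (\<bar>ln (v / \<mu>)\<bar> * real (N t \<omega>)))"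
    by (intro integrable_mult_right integrable_exp_N assms)
  have id: "(\<lambda>x. x) \<in> M \<rightarrow>\<^sub>M obs_filtration M N t" "(\<lambda>x. x) \<in> M \<rightarrow>\<^sub>M disorder_algebra"
    using subalgebra_obs_filtration[of t] subalgebra_disorder_algebra by (auto simp: subalgebra_def measurable_def)
  show "(\<lambda>\<omega>. change_kernel B v t \<omega> \<omega>) \<in> borel_measurable M"
    using measurable_compose[OF measurable_Pair[OF id] borel_measurable_change_kernel_obs[OF assms]] by simp
  show "AE \<omega> in M. norm (change_kernel B v t \<omega> \<omega>) \<le> norm (exp (\<bar>v - \<mu>\<bar> * t) * exp (\<bar>ln (v / \<mu>)\<bar> * real (N t \<omega>)))"
    using change_kernel_le[OF _ assms(3)] change_kernel_nonneg by (intro AE_I2) (simp add: exp_add[symmetric] add.commute)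
qed

text \<open>For changes up to \<open>s\<close> the cocycle identity splits off a factor free of
  \<open>\<omega>'\<close>, which leaves the integral.\<close>

lemma change_weight_split:
  assumes s: "0 \<le> s" "s \<le> t" and \<omega>: "\<omega> \<in> space M"
  shows "change_weight {0..t} v t \<omega> = likelihood_ratio v s t \<omega> * change_weight {0..s} v s \<omega> + change_weight {s<..t} v t \<omega>"
proof -
  have "change_kernel {0..t} v t \<omega> \<omega>' = likelihood_ratio v s t \<omega> * change_kernel {0..s} v s \<omega> \<omega>' + change_kernel {s<..t} v t \<omega> \<omega>'" for \<omega>'
    using s by (auto simp: change_kernel_def likelihood_ratio_mult)
  hence "change_weight {0..t} v t \<omega> = (\<integral>\<omega>'. likelihood_ratio v s t \<omega> * change_kernel {0..s} v s \<omega> \<omega>' + change_kernel {s<..t} v t \<omega> \<omega>' \<partial>M)"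
    unfolding change_weight_def by (intro Bochner_Integration.integral_cong) auto
  also have "\<dots> = (\<integral>\<omega>'. likelihood_ratio v s t \<omega> * change_kernel {0..s} v s \<omega> \<omega>' \<partial>M) + (\<integral>\<omega>'. change_kernel {s<..t} v t \<omega> \<omega>' \<partial>M)"
    by (rule Bochner_Integration.integral_add) (use s \<omega> in \<open>auto intro!: integrable_change_kernel\<close>)
  finally show ?thesis by (simp add: change_weight_def)
qed

definition survival :: "real \<Rightarrow> real" where
  "survival t = prob {\<omega> \<in> space M. \<theta> \<omega> > t}"

lemma survival_pos: "0 \<le> t \<Longrightarrow> 0 < survival t"
  using theta_tail[of t] p0_range by (simp add: survival_def)

text \<open>The prescribed masses at 0 and above 0 add up to 1.\<close>

lemma AE_theta_nonneg: "AE \<omega> in M. 0 \<le> \<theta> \<omega>"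
proof -
  have [measurable]: "\<theta> \<in> borel_measurable M" by (rule theta_rv)
  have "prob {\<omega> \<in> space M. 0 \<le> \<theta> \<omega>} = prob ({\<omega> \<in> space M. \<theta> \<omega> = 0} \<union> {\<omega> \<in> space M. \<theta> \<omega> > 0})"
    by (rule arg_cong[of _ _ prob]) auto
  also have "\<dots> = prob {\<omega> \<in> space M. \<theta> \<omega> = 0} + prob {\<omega> \<in> space M. \<theta> \<omega> > 0}"
    by (rule finite_measure_Union) auto
  also have "\<dots> = 1" using theta_zero theta_tail[of 0] by simp
  finally show ?thesis by (subst (asm) prob_Collect_eq_1) auto
qed

lemma AE_Lambda_in:
  assumes "finite V" "measure \<nu> V = 1"
  shows "AE \<omega> in M. \<Lambda> \<omega> \<in> V"
proof -
  have [measurable]: "\<Lambda> \<in> borel_measurable M" by (rule Lambda_rv)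
  have V: "V \<in> sets borel" using assms(1) by (simp add: finite_imp_closed borel_closed)
  have "prob {\<omega> \<in> space M. \<Lambda> \<omega> \<in> V} = measure (distr M borel \<Lambda>) V"
    using V by (subst measure_distr) (auto intro!: arg_cong[of _ _ prob])
  also have "\<dots> = 1" using assms(2) by (simp add: Lambda_distr)
  finally show ?thesis using V by (subst (asm) prob_Collect_eq_1) auto
qed

section \<open>The filtration enlarged by the change time and the new rate\<close>

lemma space_full_filtration: "space (full_filtration M N \<theta> \<Lambda> t) = space M"
  by (simp add: full_filtration_def space_measure_of_conv)

lemma sets_full_filtration:
  "sets (full_filtration M N \<theta> \<Lambda> t) =
     sigma_sets (space M) (sets (obs_filtration M N t) \<union> rv_sets M \<theta> \<union> rv_sets M \<Lambda>)"
  unfolding full_filtration_def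
  by (rule sets_measure_of) (use rv_sets_Pow sets.sets_into_space[of _ "obs_filtration M N t"] in auto)

lemma subalgebra_full_filtration: "subalgebra M (full_filtration M N \<theta> \<Lambda> t)"
  unfolding subalgebra_def sets_full_filtration space_full_filtration
  using rv_sets_events[OF theta_rv] rv_sets_events[OF Lambda_rv] subalgebra_obs_filtration[of t]
  by (auto simp: subalgebra_def intro!: sets.sigma_sets_subset)

lemma subalgebra_full_obs: "subalgebra (full_filtration M N \<theta> \<Lambda> t) (obs_filtration M N t)"
  unfolding subalgebra_def sets_full_filtration space_full_filtration
  by (auto intro: sigma_sets.Basic)

lemma measurable_full_filtration:
  "\<theta> \<in> borel_measurable (full_filtration M N \<theta> \<Lambda> t)" "\<Lambda> \<in> borel_measurable (full_filtration M N \<theta> \<Lambda> t)"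
  by (auto intro!: borel_measurable_if_rv_sets intro: sigma_sets.Basic simp: space_full_filtration sets_full_filtration)

end

section \<open>The odds processes\<close>

context poisson_process
begin

text \<open>The filtration contains all null sets of \<open>M\<close>. This yields adaptedness of
  the odds versions, which are only assumed measurable for \<open>M\<close>.\<close>

lemma borel_measurable_obs_AE:
  fixes X Y :: "'a \<Rightarrow> real"
  assumes Y: "Y \<in> borel_measurable (obs_filtration M N t)" and X[measurable]: "X \<in> borel_measurable M"
    and eq: "AE \<omega> in M. X \<omega> = Y \<omega>"
  shows "X \<in> borel_measurable (obs_filtration M N t)"
proof (rule measurableI)
  fix A :: "real set" assume A: "A \<in> sets borel"
  have [measurable]: "Y \<in> borel_measurable M" by (rule measurable_from_subalg[OF subalgebra_obs_filtration Y])
  define D where "D = {\<omega> \<in> space M. X \<omega> \<noteq> Y \<omega>}"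
  have D: "D \<in> null_sets M" using eq unfolding D_def by (subst (asm) AE_iff_null) auto
  have "(X -` A \<inter> space M) \<inter> D \<in> null_sets M" by (rule null_set_Int1[OF D measurable_sets[OF X A]])
  moreover have "Y -` A \<inter> space M \<in> sets (obs_filtration M N t)"
    using measurable_sets[OF Y A] by simp
  ultimately have "(Y -` A \<inter> space M - D) \<union> ((X -` A \<inter> space M) \<inter> D) \<in> sets (obs_filtration M N t)"
    using D null_sets_obs_filtration by blast
  also have "(Y -` A \<inter> space M - D) \<union> ((X -` A \<inter> space M) \<inter> D) = X -` A \<inter> space (obs_filtration M N t)"
    by (auto simp: D_def)
  finally show "X -` A \<inter> space (obs_filtration M N t) \<in> sets (obs_filtration M N t)" .
qed simp

end

section \<open>Bayes' formula for the odds, with the Markov property and the linear relation\<close>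

context poisson_disorder
begin

lemma borel_measurable_change_weight_obs:
  assumes "0 \<le> t" "B \<in> sets borel" "B \<subseteq> {0..t}"
  shows "change_weight B v t \<in> borel_measurable (obs_filtration M N t)"
  unfolding change_weight_def
  by (rule borel_measurable_expectation_pair[OF subalgebra_disorder_algebra borel_measurable_change_kernel_obs[OF assms]])

text \<open>For a change in \<open>{s<..t}\<close> the kernel reads the path only through its
  increment from the change to \<open>t\<close>.\<close>

lemma borel_measurable_change_weight_increments:
  assumes "0 \<le> s" "s \<le> t"
  shows "change_weight {s<..t} v t \<in> borel_measurable (increment_algebra M N {s<..})"
  unfolding change_weight_def
proof (rule borel_measurable_expectation_pair[OF subalgebra_disorder_algebra])
  show "(\<lambda>(x, y). change_kernel {s<..t} v t x y) \<in> borel_measurable (increment_algebra M N {s<..} \<Otimes>\<^sub>M disorder_algebra)"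
    by (rule borel_measurable_change_kernel_pair[of s]) (use assms in \<open>auto intro: borel_measurable_increment_right\<close>)
qed

text \<open>The free coefficients cover both parts of Bayes' formula: \<open>b = 0\<close> gives the
  numerator, all coefficients equal to 1 the denominator.\<close>

lemma real_cond_exp_change_kernel_sum:
  assumes t: "0 \<le> t" and V: "finite V"
  shows "AE \<omega> in M. real_cond_exp M (obs_filtration M N t)
      (\<lambda>\<omega>. (\<Sum>v\<in>V. a v * change_kernel {0..t} v t \<omega> \<omega>) + b * indicator {\<omega>. t < \<theta> \<omega>} \<omega>) \<omega>
    = (\<Sum>v\<in>V. a v * change_weight {0..t} v t \<omega>) + b * survival t"
    and "integrable M (\<lambda>\<omega>. (\<Sum>v\<in>V. a v * change_kernel {0..t} v t \<omega> \<omega>) + b * indicator {\<omega>. t < \<theta> \<omega>} \<omega>)"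
proof -
  define \<phi> where "\<phi> = (\<lambda>\<omega> \<omega>'. (\<Sum>v\<in>V. a v * change_kernel {0..t} v t \<omega> \<omega>') + b * indicator {\<omega>. t < \<theta> \<omega>} \<omega>')"
  have change_kernel_meas[measurable]: "(\<lambda>x. change_kernel {0..t} v t (fst x) (snd x)) \<in> borel_measurable (obs_filtration M N t \<Otimes>\<^sub>M disorder_algebra)" for v
    using borel_measurable_change_kernel_obs[of t "{0..t}" v] t by (simp add: case_prod_beta)
  have ind: "indicator {\<omega>. t < \<theta> \<omega>} \<omega> = (if t < \<theta> \<omega> then 1 else 0 :: real)" for \<omega> by simp
  have meas: "(\<lambda>(x, y). \<phi> x y) \<in> borel_measurable (obs_filtration M N t \<Otimes>\<^sub>M disorder_algebra)"
    unfolding \<phi>_def case_prod_beta ind by measurable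
  have [measurable]: "\<theta> \<in> borel_measurable M" by (rule theta_rv)
  have surv_int: "integrable M (\<lambda>\<omega>. indicator {\<omega>. t < \<theta> \<omega>} \<omega> :: real)"
    unfolding ind by (rule integrable_const_bound[of _ 1]) auto
  show int: "integrable M (\<lambda>\<omega>. (\<Sum>v\<in>V. a v * change_kernel {0..t} v t \<omega> \<omega>) + b * indicator {\<omega>. t < \<theta> \<omega>} \<omega>)"
    using surv_int by (intro Bochner_Integration.integrable_add Bochner_Integration.integrable_sum integrable_mult_right integrable_change_kernel_diag)
       (use t in auto)
  have "(\<integral>\<omega>. indicator {\<omega>. t < \<theta> \<omega>} \<omega> \<partial>M) = (\<integral>\<omega>. indicator {\<omega> \<in> space M. t < \<theta> \<omega>} \<omega> \<partial>M :: real)"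
    by (rule Bochner_Integration.integral_cong) (auto simp: indicator_def)
  also have "\<dots> = survival t" by (simp add: survival_def)
  finally have surv: "(\<integral>\<omega>. indicator {\<omega>. t < \<theta> \<omega>} \<omega> \<partial>M :: real) = survival t" .
  have "(\<integral>y. \<phi> \<omega> y \<partial>M) = (\<Sum>v\<in>V. a v * change_weight {0..t} v t \<omega>) + b * survival t" if "\<omega> \<in> space M" for \<omega>
  proof -
    have k: "integrable M (\<lambda>y. a v * change_kernel {0..t} v t \<omega> y)" for v
      using integrable_change_kernel[of t "{0..t}" \<omega> v] t that by (intro integrable_mult_right) auto
    have "(\<integral>y. \<phi> \<omega> y \<partial>M) = (\<integral>y. (\<Sum>v\<in>V. a v * change_kernel {0..t} v t \<omega> y) \<partial>M) + (\<integral>y. b * indicator {\<omega>. t < \<theta> \<omega>} y \<partial>M)"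
      unfolding \<phi>_def using k surv_int by (intro Bochner_Integration.integral_add) auto
    also have "(\<integral>y. (\<Sum>v\<in>V. a v * change_kernel {0..t} v t \<omega> y) \<partial>M) = (\<Sum>v\<in>V. \<integral>y. a v * change_kernel {0..t} v t \<omega> y \<partial>M)"
      by (rule Bochner_Integration.integral_sum) (rule k)
    finally show ?thesis using surv by (simp add: change_weight_def)
  qed
  moreover have "AE x in M. real_cond_exp M (obs_filtration M N t) (\<lambda>x. \<phi> x x) x = (\<integral>y. \<phi> x y \<partial>M)"
    by (rule real_cond_exp_indep[OF subalgebra_obs_filtration subalgebra_disorder_algebra indep_obs_filtration_disorder meas])
       (use int in \<open>simp add: \<phi>_def\<close>)
  ultimately show "AE \<omega> in M. real_cond_exp M (obs_filtration M N t)
      (\<lambda>\<omega>. (\<Sum>v\<in>V. a v * change_kernel {0..t} v t \<omega> \<omega>) + b * indicator {\<omega>. t < \<theta> \<omega>} \<omega>) \<omega>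
    = (\<Sum>v\<in>V. a v * change_weight {0..t} v t \<omega>) + b * survival t"
    by (auto simp: \<phi>_def elim!: AE_mp intro!: AE_I2)
qed

text \<open>A version of the likelihood without Stieltjes integral. The maximum with 0 keeps the
  start time in \<open>{0..t}\<close> also on the null event of negative \<open>\<theta>\<close>,
  which gives measurability everywhere.\<close>

definition disorder_likelihood :: "real \<Rightarrow> 'a \<Rightarrow> real" where
  "disorder_likelihood t \<omega> = likelihood_ratio (\<Lambda> \<omega>) (max 0 (min (\<theta> \<omega>) t)) t \<omega>"

lemma borel_measurable_disorder_likelihood:
  assumes t: "0 \<le> t"
  shows "disorder_likelihood t \<in> borel_measurable (full_filtration M N \<theta> \<Lambda> t)"
proof -
  let ?G = "full_filtration M N \<theta> \<Lambda> t"
  note [measurable] = measurable_full_filtration[of t]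
  have F: "(\<lambda>(\<omega>, r). real (N (max 0 (min r t)) \<omega>)) \<in> borel_measurable (obs_filtration M N t \<Otimes>\<^sub>M borel)"
    by (rule borel_measurable_right_continuous_pair)
       (use t in \<open>auto intro: borel_measurable_N_obs N_right_continuous\<close>)
  have "(\<lambda>x. x) \<in> ?G \<rightarrow>\<^sub>M obs_filtration M N t"
    using subalgebra_full_obs[of t] by (auto simp: subalgebra_def measurable_def)
  from measurable_compose[OF measurable_Pair[OF this measurable_full_filtration(1)] F]
  have [measurable]: "(\<lambda>\<omega>. real (N (max 0 (min (\<theta> \<omega>) t)) \<omega>)) \<in> borel_measurable ?G" by simp
  have [measurable]: "(\<lambda>\<omega>. real (N t \<omega>)) \<in> borel_measurable ?G"
    by (rule measurable_from_subalg[OF subalgebra_full_obs]) (use t borel_measurable_N_obs in auto)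
  show ?thesis unfolding disorder_likelihood_def[abs_def] likelihood_ratio_def by measurable
qed

text \<open>The densities agree where \<open>\<theta>\<close> is nonnegative, an almost sure event
  of \<open>G\<^sub>t\<close> that therefore passes to the restricted measure.\<close>

lemma disorder_measure_eq:
  assumes t: "0 \<le> t"
  shows "disorder_measure M N \<mu> \<theta> \<Lambda> t =
    density (restr_to_subalg M (full_filtration M N \<theta> \<Lambda> t)) (\<lambda>\<omega>. ennreal (disorder_likelihood t \<omega>))"
  unfolding disorder_measure_def
proof (rule density_cong_AE)
  let ?G = "full_filtration M N \<theta> \<Lambda> t"
  note [measurable] = measurable_full_filtration[of t]
  have "AE \<omega> in restr_to_subalg M ?G. 0 \<le> \<theta> \<omega>"
    by (rule AE_restr_to_subalg2[OF subalgebra_full_filtration AE_theta_nonneg]) measurable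
  moreover have "AE \<omega> in restr_to_subalg M ?G. \<omega> \<in> space M"
    by (rule AE_I2) (simp add: space_restr_to_subalg)
  ultimately show "AE \<omega> in restr_to_subalg M ?G.
      ennreal (likelihood N \<mu> \<theta> \<Lambda> t \<omega>) = ennreal (disorder_likelihood t \<omega>)"
    by eventually_elim (use t in \<open>simp add: likelihood_eq_likelihood_ratio disorder_likelihood_def\<close>)
qed

text \<open>Exactly one \<open>v\<close> in \<open>V\<close> equals
  \<open>\<Lambda> \<omega>\<close>, so one term survives. When the change comes after
  \<open>t\<close>, the likelihood is 1, which is the indicator term.\<close>

lemma disorder_likelihood_change_kernel:
  assumes "finite V" "\<Lambda> \<omega> \<in> V" "0 \<le> \<theta> \<omega>" "0 \<le> t"
  shows "disorder_likelihood t \<omega> * (a (\<Lambda> \<omega>) * indicator {\<omega>. \<theta> \<omega> \<le> t} \<omega>) = (\<Sum>v\<in>V. a v * change_kernel {0..t} v t \<omega> \<omega>)"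
    and "disorder_likelihood t \<omega> = (\<Sum>v\<in>V. change_kernel {0..t} v t \<omega> \<omega>) + indicator {\<omega>. t < \<theta> \<omega>} \<omega>"
proof -
  have *: "(\<Sum>v\<in>V. a v * change_kernel {0..t} v t \<omega> \<omega>) = disorder_likelihood t \<omega> * (a (\<Lambda> \<omega>) * indicator {\<omega>. \<theta> \<omega> \<le> t} \<omega>)" for a
  proof -
    have "(\<Sum>v\<in>V. a v * change_kernel {0..t} v t \<omega> \<omega>) = (\<Sum>v\<in>V. if \<Lambda> \<omega> = v then a v * change_kernel {0..t} v t \<omega> \<omega> else 0)"
      by (rule sum.cong) (auto simp: change_kernel_def)
    also have "\<dots> = a (\<Lambda> \<omega>) * change_kernel {0..t} (\<Lambda> \<omega>) t \<omega> \<omega>" using assms by simp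
    also have "\<dots> = disorder_likelihood t \<omega> * (a (\<Lambda> \<omega>) * indicator {\<omega>. \<theta> \<omega> \<le> t} \<omega>)"
      using assms by (auto simp: change_kernel_def disorder_likelihood_def indicator_def)
    finally show ?thesis .
  qed
  show "disorder_likelihood t \<omega> * (a (\<Lambda> \<omega>) * indicator {\<omega>. \<theta> \<omega> \<le> t} \<omega>) = (\<Sum>v\<in>V. a v * change_kernel {0..t} v t \<omega> \<omega>)"
    by (simp add: *)
  show "disorder_likelihood t \<omega> = (\<Sum>v\<in>V. change_kernel {0..t} v t \<omega> \<omega>) + indicator {\<omega>. t < \<theta> \<omega>} \<omega>"
    using *[of "\<lambda>_. 1"] assms by (auto simp: indicator_def disorder_likelihood_def likelihood_ratio_self min_def max_def)
qed

text \<open>What remains of the odds once the common denominator of Bayes' formula has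
  cancelled.\<close>

definition odds_formula :: "real set \<Rightarrow> nat \<Rightarrow> real \<Rightarrow> 'a \<Rightarrow> real" where
  "odds_formula V i t \<omega> = (\<Sum>v\<in>V. (v - \<mu>) ^ i * change_weight {0..t} v t \<omega>) / survival t"

lemma disorder_cond_exp_eq:
  assumes V: "finite V" "measure \<nu> V = 1" and t: "0 \<le> t"
  shows "AE \<omega> in M. disorder_cond_exp M N \<mu> \<theta> \<Lambda> t (\<lambda>\<omega>'. (\<Lambda> \<omega>' - \<mu>) ^ i * indicator {\<omega>. \<theta> \<omega> \<le> t} \<omega>') \<omega>
    = (\<Sum>v\<in>V. (v - \<mu>) ^ i * change_weight {0..t} v t \<omega>) / ((\<Sum>v\<in>V. change_weight {0..t} v t \<omega>) + survival t)"
  unfolding disorder_cond_exp_def disorder_measure_eq[OF t]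
proof (rule real_cond_exp_density_subalg[OF subalgebra_full_obs subalgebra_full_filtration])
  let ?G = "full_filtration M N \<theta> \<Lambda> t" and ?F = "obs_filtration M N t"
  let ?Z = "disorder_likelihood t"
  let ?f = "\<lambda>\<omega>'. (\<Lambda> \<omega>' - \<mu>) ^ i * indicator {\<omega>. \<theta> \<omega> \<le> t} \<omega>'"
  let ?p = "\<lambda>\<omega>. \<Sum>v\<in>V. (v - \<mu>) ^ i * change_weight {0..t} v t \<omega>"
  let ?q = "\<lambda>\<omega>. (\<Sum>v\<in>V. change_weight {0..t} v t \<omega>) + survival t"
  note [measurable] = measurable_full_filtration[of t]
  interpret S: finite_measure_subalgebra M ?F by unfold_locales (rule subalgebra_obs_filtration)
  show Z: "?Z \<in> borel_measurable ?G" by (rule borel_measurable_disorder_likelihood[OF t])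
  show "0 < ?Z x" for x by (simp add: disorder_likelihood_def likelihood_ratio_pos)
  have ind: "indicator {\<omega>. \<theta> \<omega> \<le> t} = (\<lambda>\<omega>. if \<theta> \<omega> \<le> t then 1 else 0 :: real)" by (auto simp: fun_eq_iff)
  show f: "?f \<in> borel_measurable ?G" unfolding ind by measurable
  have [measurable]: "?Z \<in> borel_measurable M" "?f \<in> borel_measurable M"
    by (rule measurable_from_subalg[OF subalgebra_full_filtration Z])
      (rule measurable_from_subalg[OF subalgebra_full_filtration f])
  have ae: "AE \<omega> in M. 0 \<le> \<theta> \<omega> \<and> \<Lambda> \<omega> \<in> V"
    using AE_theta_nonneg AE_Lambda_in[OF V] by eventually_elim simp
  \<comment> \<open>The term with factor 0 fits the expression to
    \<open>real_cond_exp_change_kernel_sum\<close>.\<close>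
  have Zf: "AE \<omega> in M. ?Z \<omega> * ?f \<omega> = (\<Sum>v\<in>V. (v - \<mu>) ^ i * change_kernel {0..t} v t \<omega> \<omega>) + 0 * indicator {\<omega>. t < \<theta> \<omega>} \<omega>"
    using ae
  proof eventually_elim
    case (elim \<omega>)
    thus ?case using disorder_likelihood_change_kernel(1)[OF V(1) _ _ t, of \<omega> "\<lambda>v. (v - \<mu>) ^ i"] by simp
  qed
  have Z1: "AE \<omega> in M. ?Z \<omega> = (\<Sum>v\<in>V. 1 * change_kernel {0..t} v t \<omega> \<omega>) + 1 * indicator {\<omega>. t < \<theta> \<omega>} \<omega>"
    using ae
  proof eventually_elim
    case (elim \<omega>)
    thus ?case using disorder_likelihood_change_kernel(2)[OF V(1) _ _ t, of \<omega>] by simp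
  qed
  note K = real_cond_exp_change_kernel_sum[OF t V(1)]
  show "integrable M ?Z"
    by (rule integrable_cong_AE[THEN iffD2, OF _ borel_measurable_integrable[OF K(2)] Z1 K(2)]) measurable
  show "integrable M (\<lambda>x. ?Z x * ?f x)"
    by (rule integrable_cong_AE[THEN iffD2, OF _ borel_measurable_integrable[OF K(2)] Zf K(2)]) measurable
  show "?p \<in> borel_measurable ?F" "?q \<in> borel_measurable ?F"
    using borel_measurable_change_weight_obs[of t "{0..t}"] t by auto
  have "AE x in M. real_cond_exp M ?F (\<lambda>x. ?Z x * ?f x) x =
      real_cond_exp M ?F (\<lambda>\<omega>. (\<Sum>v\<in>V. (v - \<mu>) ^ i * change_kernel {0..t} v t \<omega> \<omega>) + 0 * indicator {\<omega>. t < \<theta> \<omega>} \<omega>) x"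
    by (rule S.real_cond_exp_cong[OF Zf _ borel_measurable_integrable[OF K(2)]]) measurable
  thus "AE x in M. real_cond_exp M ?F (\<lambda>x. ?Z x * ?f x) x = ?p x"
    using K(1)[of "\<lambda>v. (v - \<mu>) ^ i" 0] by eventually_elim simp
  have "AE x in M. real_cond_exp M ?F ?Z x =
      real_cond_exp M ?F (\<lambda>\<omega>. (\<Sum>v\<in>V. 1 * change_kernel {0..t} v t \<omega> \<omega>) + 1 * indicator {\<omega>. t < \<theta> \<omega>} \<omega>) x"
    by (rule S.real_cond_exp_cong[OF Z1 _ borel_measurable_integrable[OF K(2)]]) measurable
  thus "AE x in M. real_cond_exp M ?F ?Z x = ?q x"
    using K(1)[of "\<lambda>v. 1" 1] by eventually_elim simp
  show "0 < ?q x" for x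
    using survival_pos[OF t] by (intro add_nonneg_pos sum_nonneg change_weight_nonneg)
  \<comment> \<open>\<open>V\<close> is finite and the weights are nonnegative, so this constant
    dominates every coefficient in the numerator.\<close>
  let ?C = "\<Sum>v\<in>V. \<bar>v - \<mu>\<bar> ^ i"
  show "\<bar>?p x\<bar> \<le> ?C * ?q x" for x
  proof -
    have "\<bar>?p x\<bar> \<le> (\<Sum>v\<in>V. \<bar>(v - \<mu>) ^ i * change_weight {0..t} v t x\<bar>)" by (rule sum_abs)
    also have "\<dots> = (\<Sum>v\<in>V. \<bar>v - \<mu>\<bar> ^ i * change_weight {0..t} v t x)"
      by (simp add: abs_mult power_abs change_weight_nonneg)
    also have "\<dots> \<le> (\<Sum>v\<in>V. ?C * change_weight {0..t} v t x)"
      by (intro sum_mono mult_right_mono change_weight_nonneg member_le_sum) (use V in auto)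
    also have "\<dots> = ?C * (\<Sum>v\<in>V. change_weight {0..t} v t x)" by (simp add: sum_distrib_left)
    also have "\<dots> \<le> ?C * ?q x"
      using survival_pos[OF t] by (intro mult_left_mono sum_nonneg) auto
    finally show ?thesis .
  qed
qed

text \<open>The posterior probability is the case of exponent 0, so both quotients have the same
  denominator and only \<open>survival t\<close> is left.\<close>

lemma odds_version_eq:
  assumes V: "finite V" "measure \<nu> V = 1" and X: "odds_version M N \<mu> \<theta> \<Lambda> i X" and t: "0 \<le> t"
  shows "AE \<omega> in M. X t \<omega> = odds_formula V i t \<omega>"
proof -
  have "AE \<omega> in M. X t \<omega> =
      disorder_cond_exp M N \<mu> \<theta> \<Lambda> t (\<lambda>\<omega>'. (\<Lambda> \<omega>' - \<mu>) ^ i * indicator {\<omega>. \<theta> \<omega> \<le> t} \<omega>') \<omega>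
        / (1 - posterior_prob M N \<mu> \<theta> \<Lambda> t \<omega>)"
    using X t by (simp add: odds_version_def)
  moreover have "AE \<omega> in M. posterior_prob M N \<mu> \<theta> \<Lambda> t \<omega> =
      (\<Sum>v\<in>V. change_weight {0..t} v t \<omega>) / ((\<Sum>v\<in>V. change_weight {0..t} v t \<omega>) + survival t)"
    using disorder_cond_exp_eq[OF V t, of 0] by (simp add: posterior_prob_def)
  ultimately show ?thesis using disorder_cond_exp_eq[OF V t, of i]
  proof eventually_elim
    case (elim \<omega>)
    let ?w = "\<Sum>v\<in>V. change_weight {0..t} v t \<omega>"
    have pos: "0 < ?w + survival t"
      using survival_pos[OF t] by (intro add_nonneg_pos sum_nonneg change_weight_nonneg)
    hence "1 - ?w / (?w + survival t) = survival t / (?w + survival t)"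
      by (simp add: diff_divide_eq_iff)
    thus ?case using pos by (simp add: elim odds_formula_def)
  qed
qed

lemma borel_measurable_odds_formula_obs: "0 \<le> t \<Longrightarrow> odds_formula V i t \<in> borel_measurable (obs_filtration M N t)"
  unfolding odds_formula_def[abs_def] using borel_measurable_change_weight_obs[of t "{0..t}"] by auto

lemma borel_measurable_odds_version:
  assumes V: "finite V" "measure \<nu> V = 1" and X: "odds_version M N \<mu> \<theta> \<Lambda> i X" and t: "0 \<le> t"
  shows "X t \<in> borel_measurable (obs_filtration M N t)"
proof (rule borel_measurable_obs_AE[OF borel_measurable_odds_formula_obs[OF t] _ odds_version_eq[OF V X t]])
  show "X t \<in> borel_measurable M" using X t by (simp add: odds_version_def)
qed

lemma markov_process_odds_formula:
  assumes V: "finite V" "measure \<nu> V = 1" "card V \<le> k"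
    and \<Phi>: "\<And>i. odds_version M N \<mu> \<theta> \<Lambda> i (\<Phi> i)"
  shows "markov_process M (obs_filtration M N) (\<lambda>t \<omega>. \<lambda>i\<in>{..<k}. \<Phi> i t \<omega>) (\<Pi>\<^sub>M i\<in>{..<k}. borel)"
proof -
  let ?S = "\<Pi>\<^sub>M i\<in>{..<k}. (borel :: real measure)"
  define X where "X = (\<lambda>t \<omega>. \<lambda>i\<in>{..<k}. \<Phi> i t \<omega>)"
  note eq = odds_version_eq[OF V(1,2) \<Phi>]
  have X: "X t \<in> obs_filtration M N t \<rightarrow>\<^sub>M ?S" if "0 \<le> t" for t
    unfolding X_def by (intro measurable_restrict borel_measurable_odds_version[OF V(1,2) \<Phi> that])
  have "\<forall>v\<in>V. \<exists>P. degree P < card V \<and> (\<forall>w\<in>V. poly P (w - \<mu>) = (if w = v then 1 else 0))"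
    using ex_interpolation_poly[OF V(1)] by blast
  then obtain P where P: "\<And>v. v \<in> V \<Longrightarrow> degree (P v) < card V"
    "\<And>v w. v \<in> V \<Longrightarrow> w \<in> V \<Longrightarrow> poly (P v) (w - \<mu>) = (if w = v then 1 else 0)"
    by (subst (asm) bchoice_iff) blast
  have "AE \<omega> in M. real_cond_exp M (obs_filtration M N s) (indicator (X t -` B \<inter> space M)) \<omega> =
      real_cond_exp M (vimage_algebra (space M) (X s) ?S) (indicator (X t -` B \<inter> space M)) \<omega>"
    if s: "0 \<le> s" and t: "s \<le> t" and B: "B \<in> sets ?S" for s t B
  proof (rule markov_transition[OF subalgebra_obs_filtration _ indep_obs_filtration_increments[OF s] X[OF s] _ _ _ B])
    let ?H = "increment_algebra M N {s<..}"
    have t0: "0 \<le> t" using s t by simp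
    show "subalgebra M ?H" by (rule subalgebra_increment_algebra) (use s in auto)
    show "X t \<in> M \<rightarrow>\<^sub>M ?S" by (rule measurable_from_subalg[OF subalgebra_obs_filtration X[OF t0]])
    \<comment> \<open>Recovers the weights at \<open>s\<close> from the vector of odds:
      \<open>survival s\<close> undoes the normalization and the coefficients of \<open>P v\<close>
      isolate the rate \<open>v\<close>.\<close>
    define W where "W = (\<lambda>v (x :: nat \<Rightarrow> real). survival s * (\<Sum>j<k. coeff (P v) j * x j))"
    \<comment> \<open>The transition map, obtained from \<open>change_weight_split\<close>; it
      depends on \<open>\<omega>\<close> only through increments after \<open>s\<close>.\<close>
    define G where "G = (\<lambda>x \<omega>. \<lambda>i\<in>{..<k}.
      (\<Sum>v\<in>V. (v - \<mu>) ^ i * (likelihood_ratio v s t \<omega> * W v x + change_weight {s<..t} v t \<omega>)) / survival t)"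
    have likelihood_ratio_meas: "likelihood_ratio v s t \<in> borel_measurable ?H" for v
      using borel_measurable_increment_right[OF s order_refl t] unfolding likelihood_ratio_def[abs_def] by measurable
    have [measurable]: "(\<lambda>z. likelihood_ratio v s t (snd z)) \<in> borel_measurable (?S \<Otimes>\<^sub>M ?H)"
      "(\<lambda>z. change_weight {s<..t} v t (snd z)) \<in> borel_measurable (?S \<Otimes>\<^sub>M ?H)" for v
      using measurable_compose[OF measurable_snd likelihood_ratio_meas]
        measurable_compose[OF measurable_snd borel_measurable_change_weight_increments[OF s t]] by auto
    have [measurable]: "(\<lambda>z. W v (fst z)) \<in> borel_measurable (?S \<Otimes>\<^sub>M ?H)" for v
      unfolding W_def by measurable
    show "(\<lambda>(x, \<omega>). G x \<omega>) \<in> ?S \<Otimes>\<^sub>M ?H \<rightarrow>\<^sub>M ?S"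
      unfolding G_def case_prod_beta by (rule measurable_restrict) measurable
    have "AE \<omega> in M. \<forall>i<k. \<Phi> i s \<omega> = odds_formula V i s \<omega>" "AE \<omega> in M. \<forall>i<k. \<Phi> i t \<omega> = odds_formula V i t \<omega>"
      using eq[OF s] eq[OF t0] by (simp_all add: AE_all_countable)
    with AE_space show "AE \<omega> in M. X t \<omega> = G (X s \<omega>) \<omega>"
    proof eventually_elim
      case (elim \<omega>)
      have "W v (X s \<omega>) = change_weight {0..s} v s \<omega>" if v: "v \<in> V" for v
      proof -
        have "W v (X s \<omega>) = (\<Sum>j<k. coeff (P v) j * (\<Sum>w\<in>V. (w - \<mu>) ^ j * change_weight {0..s} w s \<omega>))"
          unfolding W_def X_def using survival_pos[OF s]
          by (subst sum_distrib_left) (intro sum.cong, auto simp: elim odds_formula_def)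
        \<comment> \<open>The degree of \<open>P v\<close> is below \<open>card V \<le> k\<close>,
          so the first \<open>k\<close> odds suffice.\<close>
        also have "\<dots> = change_weight {0..s} v s \<omega>"
          by (rule sum_interpolation_coeffs[OF V(1) v]) (use P v V(3) in \<open>auto intro: less_le_trans\<close>)
        finally show ?thesis .
      qed
      thus ?case unfolding G_def X_def
        by (intro restrict_ext) (simp add: elim odds_formula_def change_weight_split[OF s t elim(1)])
    qed
  qed
  thus ?thesis unfolding markov_process_def adapted_process_def using X by (simp add: X_def)
qed

lemma odds_version_linear_relation:
  assumes V: "finite V" "measure \<nu> V = 1"
    and \<Phi>: "\<And>i. odds_version M N \<mu> \<theta> \<Lambda> i (\<Phi> i)"
    and p: "\<And>v. v \<in> V \<Longrightarrow> (v - \<mu>) ^ k + (\<Sum>i<k. c i * (v - \<mu>) ^ i) = 0"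
  shows "AE \<omega> in M. \<forall>t\<ge>0. \<Phi> k t \<omega> = - (\<Sum>i<k. c i * \<Phi> i t \<omega>)"
proof -
  define D where "D = (\<lambda>t \<omega>. \<Phi> k t \<omega> + (\<Sum>i<k. c i * \<Phi> i t \<omega>))"
  have D0: "AE \<omega> in M. D t \<omega> = 0" if t: "0 \<le> t" for t
  proof -
    have "AE \<omega> in M. \<forall>i. \<Phi> i t \<omega> = odds_formula V i t \<omega>"
      using odds_version_eq[OF V \<Phi> t] by (simp add: AE_all_countable)
    thus ?thesis
    proof eventually_elim
      case (elim \<omega>)
      have \<Phi>_eq: "\<Phi> i t \<omega> * survival t = (\<Sum>v\<in>V. (v - \<mu>) ^ i * change_weight {0..t} v t \<omega>)" for i
        using elim survival_pos[OF t] by (simp add: odds_formula_def)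
      \<comment> \<open>Collecting by \<open>v\<close>, the coefficient of each weight is the
        characteristic polynomial at \<open>v - \<mu>\<close>, hence 0.\<close>
      have "D t \<omega> * survival t = (\<Sum>v\<in>V. (v - \<mu>) ^ k * change_weight {0..t} v t \<omega>)
          + (\<Sum>i<k. \<Sum>v\<in>V. c i * (v - \<mu>) ^ i * change_weight {0..t} v t \<omega>)"
        by (simp add: D_def distrib_right sum_distrib_right mult.assoc \<Phi>_eq) (simp add: sum_distrib_left)
      also have "\<dots> = (\<Sum>v\<in>V. ((v - \<mu>) ^ k + (\<Sum>i<k. c i * (v - \<mu>) ^ i)) * change_weight {0..t} v t \<omega>)"
        by (subst sum.swap) (simp add: distrib_right sum_distrib_right sum.distrib)
      also have "\<dots> = 0" by (simp add: p)
      finally show ?case using survival_pos[OF t] by simp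
    qed
  qed
  \<comment> \<open>The exceptional null set depends on the time; rational times need only countably
    many of them, and right continuity does the rest.\<close>
  have "AE \<omega> in M. \<forall>t\<in>\<rat> \<inter> {0..}. D t \<omega> = 0"
    by (subst AE_ball_countable) (use D0 in \<open>auto intro: countable_Int1 countable_rat\<close>)
  moreover have "AE \<omega> in M. \<forall>i. \<forall>t\<ge>0. continuous (at_right t) (\<lambda>s. \<Phi> i s \<omega>)"
    using \<Phi> by (simp add: AE_all_countable odds_version_def)
  ultimately show ?thesis
  proof eventually_elim
    case (elim \<omega>)
    show ?case
    proof safe
      fix t :: real assume t: "0 \<le> t"
      have "continuous (at_right t) (\<lambda>s. D s \<omega>)"
        unfolding D_def using elim(2) t by (intro continuous_intros) auto
      hence "D t \<omega> = 0"
        by (intro right_continuous_eq_0[of t "\<lambda>s. D s \<omega>"]) (use elim(1) t in \<open>auto simp: continuous_within\<close>)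
      thus "\<Phi> k t \<omega> = - (\<Sum>i<k. c i * \<Phi> i t \<omega>)" by (simp add: D_def)
    qed
  qed
qed

end

section \<open>The Markov statistic for finitely many possible rates\<close>

theorem corollary3p3:
  fixes M :: "'a measure" and N :: "real \<Rightarrow> 'a \<Rightarrow> nat" and \<mu> lam p0 :: real
    and \<theta> \<Lambda> :: "'a \<Rightarrow> real" and \<nu> :: "real measure"
    and \<Phi> :: "nat \<Rightarrow> real \<Rightarrow> 'a \<Rightarrow> real"
    and k :: nat and l :: "nat \<Rightarrow> real" and c :: "nat \<Rightarrow> real"
  assumes "poisson_disorder M N \<mu> \<theta> \<Lambda> lam p0 \<nu>"
    and "\<And>i. odds_version M N \<mu> \<theta> \<Lambda> i (\<Phi> i)"
    and "\<And>i. i \<in> {1..k} \<Longrightarrow> l i > 0"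
    and "measure \<nu> (l ` {1..k}) = 1"
    and "\<And>v::real. (\<Prod>i\<in>{1..k}. v - l i + \<mu>) = v ^ k + (\<Sum>i<k. c i * v ^ i)"
  shows "sufficient_markov_statistic M (obs_filtration M N) (\<Phi> 0) {..<k} \<Phi>
    \<and> (AE \<omega> in M. \<forall>t\<ge>0. \<Phi> k t \<omega> = - (\<Sum>i<k. c i * \<Phi> i t \<omega>))"
proof
  interpret poisson_disorder M N \<mu> \<theta> \<Lambda> lam p0 \<nu> by fact
  define V where "V = l ` {1..k}"
  \<comment> \<open>Only an inequality for the cardinality, since the \<open>l i\<close> may
    coincide.\<close>
  have V: "finite V" "measure \<nu> V = 1" "card V \<le> k"
    using assms(4) card_image_le[of "{1..k}" l] by (auto simp: V_def)
  \<comment> \<open>For \<open>k = 0\<close> the support would be empty and have measure 0; so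
    \<open>\<Phi> 0\<close> belongs to the family.\<close>
  have k: "0 < k" using assms(4) by (cases k) auto
  have markov: "markov_process M (obs_filtration M N) (\<lambda>t \<omega>. \<lambda>i\<in>{..<k}. \<Phi> i t \<omega>) (\<Pi>\<^sub>M i\<in>{..<k}. borel)"
    by (rule markov_process_odds_formula[OF V assms(2)])
  have "\<Phi> i t \<in> borel_measurable (obs_filtration M N t)" if "0 \<le> t" for i t
    by (rule borel_measurable_odds_version[OF V(1,2) assms(2) that])
  thus "sufficient_markov_statistic M (obs_filtration M N) (\<Phi> 0) {..<k} \<Phi>"
    using markov k unfolding sufficient_markov_statistic_def adapted_process_def by auto
  show "AE \<omega> in M. \<forall>t\<ge>0. \<Phi> k t \<omega> = - (\<Sum>i<k. c i * \<Phi> i t \<omega>)"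
  proof (rule odds_version_linear_relation[OF V(1,2) assms(2)])
    fix v assume "v \<in> V"
    then obtain i where "i \<in> {1..k}" "v = l i" by (auto simp: V_def)
    \<comment> \<open>The polynomial identity is used at the shifted point \<open>v - \<mu>\<close>,
      where the factor with \<open>l i = v\<close> vanishes.\<close>
    hence "(\<Prod>i\<in>{1..k}. v - \<mu> - l i + \<mu>) = 0" by (intro prod_zero) auto
    thus "(v - \<mu>) ^ k + (\<Sum>i<k. c i * (v - \<mu>) ^ i) = 0" by (simp only: assms(5))
  qed
qed

end
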